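(* Let $G=Sp(2n,\mathbb{R})$, $n\ge2$, with maximal compact subgroup $K\cong U(n)$. Let $\Lambda\in\wedge^*_{\mathbb{Q},+}\cap\mathcal{C}_{\mathrm{hol}}$ and $\mu\in\wedge^*_{\mathbb{Q},+}$. The following assertions are equivalent: (i) $\mu\in\Delta_K(\mathcal{O}_\Lambda)$; (ii) for all $r\in\{1,\dots,n-1\}$ and all $(I,J,L)\in T_r^n$, $\sum_{i\in I}\mu_i+\sum_{j\in J}\Lambda_j^*\ge0$; (iii) for all $i=1,\dots,n$, $\mu_i\ge\Lambda_i$. In particular, the convex polyhedra $\Delta_K(\mathcal{O}_\Lambda)$ and $\left(\Lambda+\sum_{\beta\in\mathfrak{R}_n^+}\mathbb{R}_+\beta\right)\cap\mathfrak{t}_+^*$ are equal.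
   Context: $Sp(2n,\mathbb{R})=\{M\in GL_{2n}(\mathbb{R}):{}^tMJ_nM=J_n\}$, $J_n=\begin{pmatrix}0&I_n\\-I_n&0\end{pmatrix}$. $K$ is the subgroup of matrices $\begin{pmatrix}A&B\\-B&A\end{pmatrix}$ with $A+iB\in U(n)$; $T$ is the maximal torus corresponding to diagonal matrices of $U(n)$, and $\mathfrak{t}$ its Lie algebra, with basis $e_1,\dots,e_n$ where $e_k$ corresponds to the diagonal matrix in $\mathfrak{u}(n)$ with $k$-th entry $i$ and other entries $0$. With the dual basis $(e_k^* )$, $\xi\in\mathfrak{t}^*$ is written $\xi=(\xi_1,\dots,\xi_n)$. $\mathfrak{t}_+^*=\{\xi_1\ge\dots\ge\xi_n\}$; $\wedge^*_{\mathbb{Q}}=\mathbb{Q}^n$, $\wedge^*_{\mathbb{Q},+}=\mathbb{Q}^n\cap\mathfrak{t}_+^*$. The positive noncompact roots are $\mathfrak{R}_n^+=\{e_i^*+e_j^*:1\le i\le j\le n\}$, and $\mathcal{C}_{\mathrm{hol}}=\{\xi\in\mathfrak{t}_+^*:(\beta,\xi)>0\ \forall\beta\in\mathfrak{R}_n^+\}$, i.e. $\xi_1\ge\dots\ge\xi_n>0$. For $\lambda=(\lambda_1\ge\dots\ge\lambda_n)$, $\lambda^*=(-\lambda_n,\dots,-\lambda_1)$. $\mathcal{O}_\Lambda=G\cdot\Lambda\subset\mathfrak{g}^*$ is the coadjoint orbit ($\mathfrak{t}^*\subset\mathfrak{k}^*\subset\mathfrak{g}^*$ via the Killing form) and $\Delta_K(\mathcal{O}_\Lambda)$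 is the intersection with $\mathfrak{t}_+^*$ of the image of $\mathcal{O}_\Lambda$ under the restriction map $\mathfrak{g}^*\to\mathfrak{k}^*$. Horn triples: for $1\le r<n$, $U_r^n$ is the set of triples $(I,J,L)$ of subsets of $\{1,\dots,n\}$ of cardinality $r$ with $\sum_{i\in I}i+\sum_{j\in J}j=\sum_{\ell\in L}\ell+r(r+1)/2$. Put $T_1^n=U_1^n$ and, for general $r$, $T_r^n$ is the set of $(I,J,L)\in U_r^n$ such that for all $p<r$ and all $(F,G,H)\in T_p^r$, $\sum_{f\in F}i_f+\sum_{g\in G}j_g\le\sum_{h\in H}\ell_h+p(p+1)/2$, where $I=\{i_1<\dots<i_r\}$, $J=\{j_1<\dots<j_r\}$, $L=\{\ell_1<\dots<\ell_r\}$. *)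

theory Defs
  imports "HOL-Analysis.Analysis"
begin

text \<open>The rank \<open>n\<close> is \<open>CARD('n)\<close>, where \<open>'n\<close> is a finite linearly ordered index type; the rows and
  columns of a \<open>2n \<times> 2n\<close> matrix are indexed by \<open>'n + 'n\<close>.\<close>

type_synonym 'n sqmat = "real^('n + 'n)^('n + 'n)"

section \<open>The groups\<close>

definition block :: "real^'n^'n \<Rightarrow> real^'n^'n \<Rightarrow> real^'n^'n \<Rightarrow> real^'n^'n \<Rightarrow> ('n::finite) sqmat" where
  "block A B C D = (\<chi> i j. case i of
      Inl a \<Rightarrow> (case j of Inl b \<Rightarrow> A $ a $ b | Inr b \<Rightarrow> B $ a $ b)
    | Inr a \<Rightarrow> (case j of Inl b \<Rightarrow> C $ a $ b | Inr b \<Rightarrow> D $ a $ b))"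

definition J_mat :: "('n::finite) sqmat" where
  "J_mat = block 0 (mat 1) (- mat 1) 0"

definition Sp :: "('n::finite) sqmat set" where
  "Sp = {M. invertible M \<and> transpose M ** J_mat ** M = J_mat}"

definition conj_transpose :: "complex^'n^'n \<Rightarrow> complex^'n^'n" where
  "conj_transpose U = (\<chi> i j. cnj (U $ j $ i))"

definition unitary_group :: "(complex^'n^'n::finite) set" where
  "unitary_group = {U. conj_transpose U ** U = mat 1 \<and> U ** conj_transpose U = mat 1}"

text \<open>The embedding \<open>A + iB \<mapsto> (A, B; -B, A)\<close>, used both for \<open>U(n)\<close> and for \<open>u(n)\<close>.\<close>

definition realify :: "complex^'n^'n \<Rightarrow> ('n::finite) sqmat" where
  "realify U = (let A = (\<chi> i j. Re (U $ i $ j)); B = (\<chi> i j. Im (U $ i $ j)) in block A B (- B) A)"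

definition K_group :: "('n::finite) sqmat set" where
  "K_group = realify ` unitary_group"

definition T_group :: "('n::finite) sqmat set" where
  "T_group = realify ` {U \<in> unitary_group. \<forall>i j. i \<noteq> j \<longrightarrow> U $ i $ j = 0}"

section \<open>Lie algebras and the Killing form\<close>

text \<open>The Lie algebra of a closed matrix group, as the set of velocities at the identity.\<close>

definition lie_algebra :: "(real^'m^'m::finite) set \<Rightarrow> (real^'m^'m) set" where
  "lie_algebra H = {X. \<exists>\<gamma>. \<gamma> 0 = mat 1 \<and> (\<forall>t. \<gamma> t \<in> H) \<and> (\<gamma> has_vector_derivative X) (at (0::real))}"

definition sp_alg :: "('n::finite) sqmat set" where "sp_alg = lie_algebra Sp"
definition k_alg :: "('n::finite) sqmat set" where "k_alg = lie_algebra K_group"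
definition t_alg :: "('n::finite) sqmat set" where "t_alg = lie_algebra T_group"

definition t_basis :: "'n \<Rightarrow> ('n::finite) sqmat" where
  "t_basis k = realify (\<chi> i j. if i = k \<and> j = k then \<i> else 0)"

definition ad :: "real^'m^'m \<Rightarrow> real^'m^'m \<Rightarrow> real^'m^'m::finite" where
  "ad X Y = X ** Y - Y ** X"

text \<open>Trace of an endomorphism of a finite-dimensional subspace \<open>V\<close>, as the sum of its diagonal
  coefficients in some basis (the value does not depend on the basis).\<close>

definition trace_on :: "'a::real_vector set \<Rightarrow> ('a \<Rightarrow> 'a) \<Rightarrow> real" where
  "trace_on V \<phi> = (let B = (SOME B. independent B \<and> span B = V)
                    in \<Sum>b\<in>B. representation B (\<phi> b) b)"

definition killing :: "('n::finite) sqmat \<Rightarrow> 'n sqmat \<Rightarrow> real" where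
  "killing X Y = trace_on sp_alg (ad X \<circ> ad Y)"

section \<open>Weights, coadjoint orbits and moment polyhedra\<close>

text \<open>An element \<open>\<xi>\<close> of the dual of \<open>t_alg\<close> is given by its coordinate vector in the basis dual to
  \<open>t_basis\<close>, so \<open>\<xi> $ k\<close> is its value on \<open>t_basis k\<close>. The Killing form identifies it with the element
  \<open>killing_dual \<xi>\<close> of \<open>t_alg\<close>, and then with functionals on \<open>k_alg\<close> and \<open>sp_alg\<close>. Functionals on a
  subspace are functions that are \<open>undefined\<close> outside it.\<close>

definition killing_dual :: "real^'n \<Rightarrow> ('n::finite) sqmat" where
  "killing_dual \<xi> = (THE H. H \<in> t_alg \<and> (\<forall>k. killing H (t_basis k) = \<xi> $ k))"

definition to_k_dual :: "real^'n \<Rightarrow> ('n::finite) sqmat \<Rightarrow> real" where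
  "to_k_dual \<xi> = restrict (killing (killing_dual \<xi>)) k_alg"

definition to_g_dual :: "real^'n \<Rightarrow> ('n::finite) sqmat \<Rightarrow> real" where
  "to_g_dual \<xi> = restrict (killing (killing_dual \<xi>)) sp_alg"

definition coadjoint :: "('n::finite) sqmat \<Rightarrow> ('n sqmat \<Rightarrow> real) \<Rightarrow> 'n sqmat \<Rightarrow> real" where
  "coadjoint M f = restrict (\<lambda>X. f (matrix_inv M ** X ** M)) sp_alg"

definition coadjoint_orbit :: "real^'n \<Rightarrow> (('n::finite) sqmat \<Rightarrow> real) set" where
  "coadjoint_orbit \<Lambda> = (\<lambda>M. coadjoint M (to_g_dual \<Lambda>)) ` Sp"

definition dominant :: "(real^'n::{finite,linorder}) set" where
  "dominant = {\<xi>. \<forall>i j. i \<le> j \<longrightarrow> \<xi> $ j \<le> \<xi> $ i}"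

definition rational_dominant :: "(real^'n::{finite,linorder}) set" where
  "rational_dominant = {\<xi> \<in> dominant. \<forall>i. \<xi> $ i \<in> \<rat>}"

definition Delta_K :: "(('n::{finite,linorder}) sqmat \<Rightarrow> real) set \<Rightarrow> (real^'n::{finite,linorder}) set" where
  "Delta_K Orb = {\<xi> \<in> dominant. to_k_dual \<xi> \<in> (\<lambda>f. restrict f k_alg) ` Orb}"

definition noncompact_roots :: "(real^'n::{finite,linorder}) set" where
  "noncompact_roots = {axis i 1 + axis j 1 | i j. i \<le> j}"

text \<open>The invariant inner product on weights is a positive multiple of the standard one.\<close>

definition C_hol :: "(real^'n::{finite,linorder}) set" where
  "C_hol = {\<xi> \<in> dominant. \<forall>\<beta>\<in>noncompact_roots. \<beta> \<bullet> \<xi> > 0}"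

definition noncompact_cone :: "(real^'n::{finite,linorder}) set" where
  "noncompact_cone = {(\<Sum>\<beta>\<in>noncompact_roots. c \<beta> *\<^sub>R \<beta>) | c. \<forall>\<beta>\<in>noncompact_roots. 0 \<le> c \<beta>}"

section \<open>Horn triples\<close>

text \<open>The \<open>k\<close>-th smallest element of a finite set, counting from \<open>1\<close>.\<close>

definition nth_elem :: "'a::linorder set \<Rightarrow> nat \<Rightarrow> 'a" where
  "nth_elem A k = sorted_list_of_set A ! (k - 1)"

definition coord :: "real^'n::{finite,linorder} \<Rightarrow> nat \<Rightarrow> real" where
  "coord \<xi> k = \<xi> $ nth_elem UNIV k"

text \<open>The position of the index \<open>k\<close> in \<open>'n\<close>, counting from \<open>1\<close>, is \<open>card {..k}\<close>.\<close>

definition dual_weight :: "real^'n::{finite,linorder} \<Rightarrow> real^'n::{finite,linorder}" where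
  "dual_weight \<xi> = (\<chi> k. - coord \<xi> (CARD('n) + 1 - card {..k}))"

definition horn_U :: "nat \<Rightarrow> nat \<Rightarrow> (nat set \<times> nat set \<times> nat set) set" where
  "horn_U r n = {(I, J, L). I \<subseteq> {1..n} \<and> J \<subseteq> {1..n} \<and> L \<subseteq> {1..n} \<and>
     card I = r \<and> card J = r \<and> card L = r \<and> \<Sum>I + \<Sum>J = \<Sum>L + r * (r + 1) div 2}"

text \<open>For \<open>r = 1\<close> the recursive condition is vacuous, so \<open>horn_T 1 n = horn_U 1 n\<close>.\<close>

function horn_T :: "nat \<Rightarrow> nat \<Rightarrow> (nat set \<times> nat set \<times> nat set) set" where
  "horn_T r n = {(I, J, L) \<in> horn_U r n. \<forall>p\<in>{1..<r}. \<forall>(F, G, H) \<in> horn_T p r.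
     (\<Sum>f\<in>F. nth_elem I f) + (\<Sum>g\<in>G. nth_elem J g) \<le> (\<Sum>h\<in>H. nth_elem L h) + p * (p + 1) div 2}"
  by auto
termination by (relation "Wellfounded.measure fst") auto

declare horn_T.simps [simp del]

end

theory Submission
  imports Defs
begin

text \<open>The Killing form of \<open>sp(2n)\<close> is \<open>(2n + 2) tr(XY)\<close>, so \<open>\<mu>\<close> lies in the moment polyhedron iff
  for some symplectic \<open>M\<close> the positive definite matrix \<open>Y = M diag(\<Lambda>, \<Lambda>) M\<^sup>T\<close> and \<open>diag(\<mu>, \<mu>)\<close> have
  the same part commuting with \<open>J\<close>. Split \<open>M\<^sup>T\<close> into its parts \<open>u\<close>, \<open>w\<close> commuting and anticommuting
  with \<open>J\<close>: then \<open>|x|\<^sup>2 = |u x|\<^sup>2 - |w x|\<^sup>2\<close> and \<open>q\<^sub>\<mu>(x) = q\<^sub>\<Lambda>(u x) + q\<^sub>\<Lambda>(w x)\<close> for the weighted sums of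
  squares \<open>q\<close>. A Courant-Fischer argument gives \<open>\<mu>\<^sub>m \<ge> \<Lambda>\<^sub>m\<close> for all \<open>m\<close>, and diagonal \<open>M\<close> realise all
  such \<open>\<mu>\<close>. As \<open>\<Lambda>\<close> is decreasing, the Horn inequalities follow from \<open>\<mu>\<^sub>i \<ge> \<Lambda>\<^sub>i\<close> and the bounds
  \<open>i\<^sub>k + j\<^sub>r\<^sub>+\<^sub>1\<^sub>-\<^sub>k \<le> n + 1\<close>, and those with \<open>r = 1\<close>, \<open>L = {n}\<close> are the inequalities \<open>\<mu>\<^sub>i \<ge> \<Lambda>\<^sub>i\<close>.\<close>

section \<open>Lie algebras of matrix groups\<close>

lemma bounded_bilinear_matrix_matrix_mult:
  "bounded_bilinear ((**) :: real^'n::finite^'m::finite \<Rightarrow> real^'p::finite^'n \<Rightarrow> real^'p^'m)"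
  by (rule bilinear_conv_bounded_bilinear[THEN iffD1])
    (auto simp: bilinear_def vec_eq_iff matrix_matrix_mult_def sum.distrib algebra_simps
      sum_distrib_left intro!: linearI)

interpretation matrix_mult: bounded_bilinear "(**) :: real^'n::finite^'m::finite \<Rightarrow> real^'p::finite^'n \<Rightarrow> real^'p^'m"
  by (rule bounded_bilinear_matrix_matrix_mult)

lemma bounded_linear_transpose: "bounded_linear (transpose :: real^'n::finite^'m::finite \<Rightarrow> real^'m^'n)"
  by (rule linear_linear[THEN iffD2]) (auto simp: vec_eq_iff transpose_def intro!: linearI)

lemmas matrix_bilinear =
  matrix_mult.add_left matrix_mult.add_right matrix_mult.diff_left matrix_mult.diff_right matrix_mult.minus_left matrix_mult.minus_right
  matrix_mult.scaleR_left matrix_mult.scaleR_right matrix_mult.zero_left matrix_mult.zero_right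

lemmas transpose_linear =
  linear_add[OF bounded_linear.linear, OF bounded_linear_transpose]
  linear_diff[OF bounded_linear.linear, OF bounded_linear_transpose]
  linear_neg[OF bounded_linear.linear, OF bounded_linear_transpose]
  linear_scale[OF bounded_linear.linear, OF bounded_linear_transpose]
  linear_0[OF bounded_linear.linear, OF bounded_linear_transpose]

text \<open>The curve is the Cayley transform \<open>(1 + tX/2)(1 - tX/2)\<^sup>-\<^sup>1\<close> for small \<open>t\<close> and constant elsewhere.\<close>

lemma cayley_curve:
  fixes X :: "real^'m::finite^'m"
  obtains \<gamma> where "\<gamma> 0 = mat 1" "(\<gamma> has_vector_derivative X) (at (0::real))"
    "\<And>t A. A ** X = X ** A \<Longrightarrow> A ** \<gamma> t = \<gamma> t ** A"
    "\<And>t Q. transpose X ** Q + Q ** X = 0 \<Longrightarrow> transpose (\<gamma> t) ** Q ** \<gamma> t = Q"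
proof -
  obtain C where C: "C > 0" "\<And>(A::real^'m^'m) (B::real^'m^'m). norm (A ** B) \<le> norm A * norm B * C"
    using matrix_mult.pos_bounded by blast
  \<comment> \<open>For \<open>\<bar>t\<bar> < e\<close> this gives
    \<open>\<bar>t\<bar> * C * norm X \<le> 1\<close>, so \<open>Z \<mapsto> (t/2) X Z\<close> at
    least halves norms. The summand 1 keeps the quotient meaningful when
    \<open>X = 0\<close>.\<close>
  define e where "e = 1 / (C * (norm X + 1))"
  have e: "e > 0" using C by (auto simp: e_def intro!: mult_pos_pos add_nonneg_pos)
  have small: "norm ((t/2) *\<^sub>R (X ** Z)) \<le> norm Z / 2" if "\<bar>t\<bar> < e" for t and Z :: "real^'m^'m"
  proof -
    have "\<bar>t\<bar> * (C * (norm X + 1)) \<le> 1"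
      using that C(1) by (simp add: e_def pos_less_divide_eq add_nonneg_pos del: distrib_left_numeral)
    moreover have "\<bar>t\<bar> * (C * norm X) \<le> \<bar>t\<bar> * (C * (norm X + 1))"
      using C by (intro mult_left_mono) auto
    ultimately have 1: "\<bar>t\<bar> * (C * norm X) \<le> 1" by linarith
    have "norm ((t/2) *\<^sub>R (X ** Z)) \<le> \<bar>t\<bar>/2 * (norm X * norm Z * C)"
      using C(2)[of X Z] by (auto intro!: mult_left_mono)
    also have "\<dots> = (\<bar>t\<bar> * (C * norm X)) * (norm Z / 2)" by simp
    also have "\<dots> \<le> 1 * (norm Z / 2)" using 1 by (intro mult_right_mono) auto
    finally show ?thesis by simp
  qed
  have "\<exists>R. (mat 1 - (t/2) *\<^sub>R X) ** R = mat 1" if "\<bar>t\<bar> < e" for t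
  proof -
    \<comment> \<open>Left multiplication by \<open>1 - tX/2\<close> is an injective endomorphism of
      a finite-dimensional space, hence surjective, and a preimage of \<open>mat 1\<close> is the
      inverse \<open>R t\<close>.\<close>
    define L where "L = (\<lambda>Z. (mat 1 - (t/2) *\<^sub>R X) ** Z :: real^'m^'m)"
    have lin: "linear L" unfolding L_def by (intro linearI) (simp_all add: matrix_bilinear)
    have "inj L"
    proof (rule linear_injective_0[OF lin, THEN iffD2], intro allI impI)
      fix Z assume "L Z = 0"
      then have "Z = (t/2) *\<^sub>R (X ** Z)" by (simp add: L_def matrix_bilinear)
      then have "norm Z \<le> norm Z / 2" using small[OF that, of Z] by simp
      then show "Z = 0" by simp
    qed
    then have "surj L" using lin linear_injective_imp_surjective by blast
    then show ?thesis unfolding L_def by (metis surjD)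
  qed
  then obtain R where R: "\<And>t. \<bar>t\<bar> < e \<Longrightarrow> (mat 1 - (t/2) *\<^sub>R X) ** R t = mat 1" by metis
  then have R': "\<And>t. \<bar>t\<bar> < e \<Longrightarrow> R t ** (mat 1 - (t/2) *\<^sub>R X) = mat 1"
    using matrix_left_right_inverse by blast
  define \<gamma> where "\<gamma> t = (if \<bar>t\<bar> < e then (mat 1 + (t/2) *\<^sub>R X) ** R t else mat 1)" for t
  have "R 0 = mat 1" using R[of 0] e by simp
  then have 0: "\<gamma> 0 = mat 1" by (simp add: \<gamma>_def)
  \<comment> \<open>Inserting \<open>R = 1 + (t/2) X R\<close> twice into the definition of
    \<open>\<gamma>\<close> leaves exactly \<open>(t\<^sup>2/2) X X R\<close> beyond first order,
    and \<open>R\<close> stays bounded because of \<open>small\<close>.\<close>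
  have bound: "norm (\<gamma> t - mat 1 - t *\<^sub>R X) \<le> t\<^sup>2 * norm X * (norm X * norm (mat 1 :: real^'m^'m) * C * C)"
    if "\<bar>t\<bar> < e" for t
  proof -
    have R1: "R t = mat 1 + (t/2) *\<^sub>R (X ** R t)"
      using R[OF that] by (simp add: matrix_bilinear algebra_simps)
    have "norm (R t) \<le> norm (mat 1 :: real^'m^'m) + norm (R t) / 2"
      using small[OF that, of "R t"] R1 norm_triangle_ineq by (metis add_left_mono order_trans)
    then have nR: "norm (R t) \<le> 2 * norm (mat 1 :: real^'m^'m)" by simp
    have "\<gamma> t = mat 1 + t *\<^sub>R (X ** R t)"
    proof -
      have "\<gamma> t = R t + (t/2) *\<^sub>R (X ** R t)" using that by (simp add: \<gamma>_def matrix_bilinear)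
      also have "\<dots> = mat 1 + ((t/2) *\<^sub>R (X ** R t) + (t/2) *\<^sub>R (X ** R t))"
        using R1 by (metis add.assoc)
      also have "(t/2) *\<^sub>R (X ** R t) + (t/2) *\<^sub>R (X ** R t) = t *\<^sub>R (X ** R t)"
        by (simp flip: scaleR_add_left)
      finally show ?thesis .
    qed
    also have "X ** R t = X + (t/2) *\<^sub>R (X ** (X ** R t))"
      by (subst R1) (simp add: matrix_bilinear)
    finally have "norm (\<gamma> t - mat 1 - t *\<^sub>R X) = t\<^sup>2/2 * norm (X ** (X ** R t))"
      by (simp add: algebra_simps power2_eq_square)
    also have "\<dots> \<le> t\<^sup>2/2 * (norm X * (norm X * (2 * norm (mat 1 :: real^'m^'m)) * C) * C)"
    proof (intro mult_left_mono)
      have "norm (X ** R t) \<le> norm X * norm (R t) * C" by (rule C)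
      also have "\<dots> \<le> norm X * (2 * norm (mat 1 :: real^'m^'m)) * C"
        using nR C by (intro mult_right_mono mult_left_mono) auto
      finally have *: "norm (X ** R t) \<le> norm X * (2 * norm (mat 1 :: real^'m^'m)) * C" .
      have "norm (X ** (X ** R t)) \<le> norm X * norm (X ** R t) * C" by (rule C)
      also have "\<dots> \<le> norm X * (norm X * (2 * norm (mat 1 :: real^'m^'m)) * C) * C"
        using * C by (intro mult_right_mono mult_left_mono) auto
      finally show "norm (X ** (X ** R t)) \<le> norm X * (norm X * (2 * norm (mat 1 :: real^'m^'m)) * C) * C" .
    qed auto
    finally show ?thesis by (simp add: algebra_simps)
  qed
  define c where "c = norm X * (norm X * norm (mat 1 :: real^'m^'m) * C * C)"
  have "c \<ge> 0" using C by (simp add: c_def)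
  have deriv: "(\<gamma> has_vector_derivative X) (at 0)"
    unfolding has_vector_derivative_def has_derivative_at_alt
  proof (intro conjI allI impI bounded_linear_scaleR_left)
    fix \<epsilon> :: real assume "\<epsilon> > 0"
    \<comment> \<open>The second bound turns the quadratic remainder \<open>c y\<^sup>2\<close> into
      at most \<open>\<epsilon> \<bar>y\<bar>\<close>; since \<open>c = 0\<close> is possible,
      \<open>c + 1\<close> is the denominator.\<close>
    define d where "d = min e (\<epsilon> / (c + 1))"
    have "d > 0" using e \<open>c \<ge> 0\<close> \<open>\<epsilon> > 0\<close> by (simp add: d_def)
    moreover have "norm (\<gamma> y - \<gamma> 0 - (y - 0) *\<^sub>R X) \<le> \<epsilon> * norm (y - 0)" if "norm (y - 0) < d" for y
    proof -
      have "\<bar>y\<bar> < e" "\<bar>y\<bar> * (c + 1) \<le> \<epsilon>"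
        using that \<open>c \<ge> 0\<close> by (auto simp: d_def field_simps)
      then have "\<bar>y\<bar> * c \<le> \<epsilon>" by (simp add: algebra_simps)
      have "norm (\<gamma> y - \<gamma> 0 - (y - 0) *\<^sub>R X) \<le> y\<^sup>2 * c"
        using bound[OF \<open>\<bar>y\<bar> < e\<close>] by (simp add: 0 c_def mult.assoc)
      also have "\<dots> = \<bar>y\<bar> * (\<bar>y\<bar> * c)"
        by (metis abs_mult_self_eq mult.assoc power2_eq_square)
      also have "\<dots> \<le> \<bar>y\<bar> * \<epsilon>" by (intro mult_left_mono \<open>\<bar>y\<bar> * c \<le> \<epsilon>\<close>) auto
      finally show ?thesis by (simp add: mult.commute)
    qed
    ultimately show "\<exists>d>0. \<forall>y. norm (y - 0) < d \<longrightarrow>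
      norm (\<gamma> y - \<gamma> 0 - (y - 0) *\<^sub>R X) \<le> \<epsilon> * norm (y - 0)" by blast
  qed
  have comm: "A ** \<gamma> t = \<gamma> t ** A" if "A ** X = X ** A" for t A
  proof (cases "\<bar>t\<bar> < e")
    case True
    let ?N = "mat 1 - (t/2) *\<^sub>R X" and ?P = "mat 1 + (t/2) *\<^sub>R X"
    have N: "A ** ?N = ?N ** A" and P: "A ** ?P = ?P ** A" using that by (simp_all add: matrix_bilinear)
    have "A ** R t = (R t ** ?N) ** A ** R t" using R'[OF True] by simp
    also have "\<dots> = R t ** (?N ** A) ** R t" by (simp only: matrix_mul_assoc)
    also have "\<dots> = R t ** A ** (?N ** R t)" by (simp only: N[symmetric] matrix_mul_assoc)
    also have "\<dots> = R t ** A" using R[OF True] by simp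
    finally have "A ** R t = R t ** A" .
    then have "A ** (?P ** R t) = (?P ** R t) ** A"
      by (metis P matrix_mul_assoc)
    then show ?thesis using True by (simp add: \<gamma>_def)
  qed (simp add: \<gamma>_def)
  have form: "transpose (\<gamma> t) ** Q ** \<gamma> t = Q" if "transpose X ** Q + Q ** X = 0" for t Q
  proof (cases "\<bar>t\<bar> < e")
    case True
    let ?N = "mat 1 - (t/2) *\<^sub>R X" and ?P = "mat 1 + (t/2) *\<^sub>R X"
    have *: "transpose X ** Q = - (Q ** X)" using that by (simp add: eq_neg_iff_add_eq_0)
    \<comment> \<open>Moving \<open>Q\<close> past a transposed factor exchanges
      \<open>1 + tX/2\<close> and \<open>1 - tX/2\<close>. As these two commute, numerators and
      denominators cancel in pairs.\<close>
    have PQ: "transpose ?P ** Q = Q ** ?N" and NQ: "transpose ?N ** Q = Q ** ?P"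
      by (simp_all add: matrix_bilinear transpose_linear *)
    have NP: "?N ** ?P = ?P ** ?N"
      by (simp add: matrix_bilinear algebra_simps)
    have "transpose (\<gamma> t) ** Q ** \<gamma> t = transpose (R t) ** (transpose ?P ** Q) ** ?P ** R t"
      using True by (simp add: \<gamma>_def matrix_transpose_mul matrix_mul_assoc)
    also have "\<dots> = transpose (R t) ** Q ** (?N ** ?P) ** R t"
      by (simp only: PQ matrix_mul_assoc)
    also have "\<dots> = transpose (R t) ** (Q ** ?P) ** (?N ** R t)"
      by (simp only: NP matrix_mul_assoc)
    also have "\<dots> = transpose (R t) ** transpose ?N ** Q"
      using R[OF True] by (simp add: NQ[symmetric] matrix_mul_assoc)
    also have "\<dots> = Q" using R[OF True] by (simp flip: matrix_transpose_mul)
    finally show ?thesis .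
  qed (simp add: \<gamma>_def)
  show ?thesis using that 0 deriv comm form by blast
qed

text \<open>Every group in question is cut out by preserving bilinear forms and commuting with matrices.\<close>

lemma lie_algebra_eq:
  fixes H :: "(real^'m::finite^'m) set"
  assumes H: "H = {M. (\<forall>Q\<in>\<Q>. transpose M ** Q ** M = Q) \<and> (\<forall>A\<in>\<A>. A ** M = M ** A)}"
  shows "lie_algebra H = {X. (\<forall>Q\<in>\<Q>. transpose X ** Q + Q ** X = 0) \<and> (\<forall>A\<in>\<A>. A ** X = X ** A)}"
proof (intro equalityI subsetI CollectI conjI ballI)
  fix X assume "X \<in> lie_algebra H"
  then obtain \<gamma> where \<gamma>: "\<gamma> 0 = mat 1" "\<And>t. \<gamma> t \<in> H" "(\<gamma> has_vector_derivative X) (at (0::real))"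
    unfolding lie_algebra_def by auto
  { fix Q assume "Q \<in> \<Q>"
    then have eq: "(\<lambda>t. transpose (\<gamma> t) ** (Q ** \<gamma> t)) = (\<lambda>t. Q)"
      using \<gamma>(2) by (auto simp: H matrix_mul_assoc)
    have "((\<lambda>t. transpose (\<gamma> t) ** (Q ** \<gamma> t)) has_vector_derivative
        transpose (\<gamma> 0) ** (Q ** X) + transpose X ** (Q ** \<gamma> 0)) (at 0)"
      by (intro matrix_mult.has_vector_derivative bounded_linear.has_vector_derivative[OF bounded_linear_transpose]
          bounded_linear.has_vector_derivative[OF matrix_mult.bounded_linear_right] \<gamma>)
    then show "transpose X ** Q + Q ** X = 0"
      unfolding eq using vector_derivative_unique_at[OF _ has_vector_derivative_const]
      by (fastforce simp: \<gamma>(1) add.commute) }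
  { fix A assume "A \<in> \<A>"
    then have eq: "(\<lambda>t. A ** \<gamma> t) = (\<lambda>t. \<gamma> t ** A)" using \<gamma>(2) by (auto simp: H)
    have "((\<lambda>t. A ** \<gamma> t) has_vector_derivative A ** X) (at 0)"
      by (intro bounded_linear.has_vector_derivative[OF matrix_mult.bounded_linear_right] \<gamma>)
    moreover have "((\<lambda>t. \<gamma> t ** A) has_vector_derivative X ** A) (at 0)"
      by (intro bounded_linear.has_vector_derivative[OF matrix_mult.bounded_linear_left] \<gamma>)
    ultimately show "A ** X = X ** A" unfolding eq by (rule vector_derivative_unique_at) }
next
  fix X
  assume "X \<in> {X. (\<forall>Q\<in>\<Q>. transpose X ** Q + Q ** X = 0) \<and> (\<forall>A\<in>\<A>. A ** X = X ** A)}"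
  with cayley_curve[of X] show "X \<in> lie_algebra H"
    unfolding lie_algebra_def H mem_Collect_eq by metis
qed

section \<open>Traces of linear maps on matrices\<close>

text \<open>The map \<open>\<phi> \<circ> P\<close> has its image in \<open>V\<close> and agrees
  with \<open>\<phi>\<close> there, so its trace over the ambient space is the trace of
  \<open>\<phi>\<close> on \<open>V\<close>. This trades the arbitrarily chosen basis of
  \<open>V\<close> for the standard orthonormal one.\<close>

lemma trace_on_eq:
  fixes V :: "'a::euclidean_space set"
  assumes V: "subspace V" and \<phi>: "linear \<phi>" "\<And>x. x \<in> V \<Longrightarrow> \<phi> x \<in> V"
    and P: "linear P" "\<And>x. P x \<in> V" "\<And>x. x \<in> V \<Longrightarrow> P x = x"
  shows "trace_on V \<phi> = (\<Sum>i\<in>Basis. \<phi> (P i) \<bullet> i)"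
proof -
  define B where "B = (SOME B. independent B \<and> span B = V)"
  have "\<exists>B. independent B \<and> span B = V"
    using maximal_independent_subset[of V] span_minimal V by (metis subset_antisym)
  then have "independent B \<and> span B = V" unfolding B_def by (rule someI_ex)
  then have B: "independent B" "span B = V" by auto
  have fin: "finite B" using B(1) by (rule finiteI_independent)
  define r where "r b x = representation B (\<phi> (P x)) b" for b x
  have lin: "linear (r b)" for b
    unfolding r_def
    by (intro linearI)
      (simp_all add: linear_add[OF P(1)] linear_add[OF \<phi>(1)] linear_scale[OF P(1)] linear_scale[OF \<phi>(1)]
        representation_add[OF B(1)] representation_scale[OF B(1)] B(2) \<phi>(2) P(2))
  have "(\<Sum>i\<in>Basis. \<phi> (P i) \<bullet> i) = (\<Sum>i\<in>Basis. (\<Sum>b\<in>B. r b i *\<^sub>R b) \<bullet> i)"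
    unfolding r_def using sum_representation_eq[OF B(1) _ fin subset_refl] B(2) \<phi>(2) P(2) by simp
  also have "\<dots> = (\<Sum>b\<in>B. \<Sum>i\<in>Basis. (b \<bullet> i) *\<^sub>R r b i)"
    by (subst sum.swap) (simp add: inner_sum_left mult.commute)
  also have "\<dots> = (\<Sum>b\<in>B. r b (\<Sum>i\<in>Basis. (b \<bullet> i) *\<^sub>R i))"
    by (simp add: linear_sum[OF lin] linear_scale[OF lin] o_def)
  also have "\<dots> = (\<Sum>b\<in>B. representation B (\<phi> b) b)"
    using B span_base[of _ B] P(3) by (simp add: euclidean_representation r_def)
  finally show ?thesis by (simp add: trace_on_def Let_def B_def[symmetric])
qed

lemma sum_Basis_matrix:
  fixes f :: "real^'m::finite^'k::finite \<Rightarrow> real"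
  shows "(\<Sum>u\<in>Basis. f u) = (\<Sum>i\<in>UNIV. \<Sum>j\<in>UNIV. f (axis i (axis j 1)))"
proof -
  have B: "(Basis :: (real^'m^'k) set) = (\<lambda>(i, j). axis i (axis j 1)) ` (UNIV \<times> UNIV)"
    by (auto simp: Basis_vec_def image_iff)
  have inj: "inj_on (\<lambda>(i, j). axis i (axis j 1) :: real^'m^'k) (UNIV \<times> UNIV)"
    by (auto simp: inj_on_def axis_eq_axis)
  show ?thesis
    unfolding B sum.reindex[OF inj] by (simp add: sum.cartesian_product split_def)
qed

lemma matrix_unit_mult_nth:
  fixes A B :: "real^'m::finite^'m"
  shows "(A ** axis i (axis j 1) ** B) $ k $ l = A $ k $ i * B $ j $ l"
  by (simp add: matrix_matrix_mult_def axis_def if_distrib[where f="\<lambda>v. v $ _"] if_distrib[where f="\<lambda>x. _ * x"]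
      if_distrib[where f="\<lambda>x. x * _"] cong: if_cong)

lemma transpose_matrix_unit: "transpose (axis i (axis j 1) :: real^'m::finite^'m) = axis j (axis i 1)"
  by (auto simp: transpose_def axis_def vec_eq_iff)

text \<open>Under the identification of matrices with a tensor product,
  \<open>u \<mapsto> A u B\<close> acts on the two factors separately, so its trace is
  multiplicative.\<close>

lemma sum_Basis_mult:
  fixes A B :: "real^'m::finite^'m"
  shows "(\<Sum>u\<in>Basis. (A ** u ** B) \<bullet> u) = trace A * trace B"
  by (simp add: sum_Basis_matrix inner_axis matrix_unit_mult_nth trace_def sum_product)

text \<open>Transposition swaps the two tensor factors, which merges the two traces into one.
  Together with \<open>sum_Basis_mult\<close> this evaluates every term of the Killing form.\<close>

lemma sum_Basis_mult_transpose:
  fixes A B :: "real^'m::finite^'m"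
  shows "(\<Sum>u\<in>Basis. (A ** transpose u ** B) \<bullet> u) = trace (A ** transpose B)"
proof -
  have "(\<Sum>u\<in>Basis. (A ** transpose u ** B) \<bullet> u) = (\<Sum>i\<in>UNIV. \<Sum>j\<in>UNIV. A $ i $ j * B $ i $ j)"
    by (simp add: sum_Basis_matrix inner_axis transpose_matrix_unit matrix_unit_mult_nth)
  then show ?thesis by (simp add: trace_def matrix_matrix_mult_def transpose_def)
qed

section \<open>The Lie algebras \<open>sp\<close>, \<open>k\<close> and \<open>t\<close>\<close>

lemma sum_UNIV_Plus:
  fixes f :: "'a::finite + 'b::finite \<Rightarrow> 'c::comm_monoid_add"
  shows "(\<Sum>i\<in>UNIV. f i) = (\<Sum>a\<in>UNIV. f (Inl a)) + (\<Sum>b\<in>UNIV. f (Inr b))"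
  using sum.Plus[of UNIV UNIV f] by simp

lemma all_sum_iff: "(\<forall>i. P i) \<longleftrightarrow> (\<forall>a. P (Inl a)) \<and> (\<forall>b. P (Inr b))"
  by (metis sumE)

lemma block_nth [simp]:
  "block A B C D $ Inl a $ Inl b = A $ a $ b" "block A B C D $ Inl a $ Inr b = B $ a $ b"
  "block A B C D $ Inr a $ Inl b = C $ a $ b" "block A B C D $ Inr a $ Inr b = D $ a $ b"
  by (simp_all add: block_def)

lemma J_mult_nth [simp]:
  "(J_mat ** X) $ Inl a $ j = X $ Inr a $ j" "(J_mat ** X) $ Inr a $ j = - X $ Inl a $ j"
  by (simp_all add: matrix_matrix_mult_def J_mat_def sum_UNIV_Plus mat_def if_distrib[where f="\<lambda>x. x * _"]
      sum_negf cong: if_cong)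

lemma mult_J_nth [simp]:
  "(X ** J_mat) $ i $ Inl b = - X $ i $ Inr b" "(X ** J_mat) $ i $ Inr b = X $ i $ Inl b"
  by (simp_all add: matrix_matrix_mult_def J_mat_def sum_UNIV_Plus mat_def if_distrib[where f="\<lambda>x. _ * x"]
      sum_negf cong: if_cong)

lemma J_mat_nth [simp]:
  "J_mat $ Inl a $ Inl b = 0" "J_mat $ Inl a $ Inr b = (if a = b then 1 else 0)"
  "J_mat $ Inr a $ Inl b = (if a = b then - 1 else 0)" "J_mat $ Inr a $ Inr b = 0"
  by (simp_all add: J_mat_def mat_def)

lemma J_mat_square: "J_mat ** J_mat = - mat 1"
  by (simp add: vec_eq_iff all_sum_iff mat_def)

lemma transpose_J_mat: "transpose J_mat = - J_mat"
  by (simp add: vec_eq_iff all_sum_iff transpose_def)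

lemma J_J_mult [simp]: "J_mat ** (J_mat ** X) = - X" "X ** J_mat ** J_mat = - X"
  by (simp_all add: matrix_mul_assoc J_mat_square matrix_bilinear) (simp add: J_mat_square matrix_bilinear flip: matrix_mul_assoc)

lemma Sp_eq: "Sp = {M. transpose M ** J_mat ** M = J_mat}"
proof -
  have "invertible M" if "transpose M ** J_mat ** M = J_mat" for M :: "'a sqmat"
  proof -
    have "(- (J_mat ** transpose M ** J_mat)) ** M = mat 1"
      using that by (simp add: matrix_bilinear J_mat_square flip: matrix_mul_assoc)
    then show ?thesis using invertible_left_inverse by blast
  qed
  then show ?thesis by (auto simp: Sp_def)
qed

lemma sp_alg_eq: "sp_alg = {X. transpose X ** J_mat + J_mat ** X = 0}"
  unfolding sp_alg_def using lie_algebra_eq[of Sp "{J_mat}" "{}"] by (auto simp: Sp_eq)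

lemma realify_nth [simp]:
  "realify U $ Inl a $ Inl b = Re (U $ a $ b)" "realify U $ Inl a $ Inr b = Im (U $ a $ b)"
  "realify U $ Inr a $ Inl b = - Im (U $ a $ b)" "realify U $ Inr a $ Inr b = Re (U $ a $ b)"
  by (simp_all add: realify_def Let_def)

lemma realify_mult: "realify (U ** V) = realify U ** realify V"
  by (simp add: vec_eq_iff all_sum_iff matrix_matrix_mult_def sum_UNIV_Plus sum.distrib sum_subtractf
      sum_negf algebra_simps)

lemma realify_conj_transpose: "realify (conj_transpose U) = transpose (realify U)"
  by (simp add: vec_eq_iff all_sum_iff transpose_def conj_transpose_def)

lemma realify_mat_1: "realify (mat 1) = mat 1"
  by (simp add: vec_eq_iff all_sum_iff mat_def)

lemma realify_inject: "realify U = realify V \<longleftrightarrow> U = V"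
  by (auto simp: vec_eq_iff all_sum_iff complex_eq_iff)

lemma unitary_realify: "U \<in> unitary_group \<longleftrightarrow> transpose (realify U) ** realify U = mat 1"
  unfolding unitary_group_def mem_Collect_eq
  by (metis matrix_left_right_inverse realify_conj_transpose realify_inject realify_mat_1 realify_mult)

text \<open>\<open>J_mat\<close> is the image of \<open>\<i>\<close> times the identity, so
  commuting with it is complex linearity.\<close>

lemma range_realify: "M \<in> range realify \<longleftrightarrow> J_mat ** M = M ** J_mat"
proof
  assume "J_mat ** M = M ** J_mat"
  then have "\<And>i j. (J_mat ** M) $ i $ j = (M ** J_mat) $ i $ j" by simp
  from this[of "Inl _" "Inl _"] this[of "Inl _" "Inr _"]
  have "M $ Inr a $ Inl b = - M $ Inl a $ Inr b" "M $ Inr a $ Inr b = M $ Inl a $ Inl b" for a b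
    by auto
  then have "M = realify (\<chi> a b. Complex (M $ Inl a $ Inl b) (M $ Inl a $ Inr b))"
    by (simp add: vec_eq_iff all_sum_iff)
  then show "M \<in> range realify" by blast
qed (auto simp: vec_eq_iff all_sum_iff)

lemma K_group_eq: "K_group = {M. transpose M ** M = mat 1 \<and> J_mat ** M = M ** J_mat}"
  unfolding K_group_def by (auto simp: unitary_realify simp flip: range_realify)

lemma k_alg_eq: "k_alg = {X. transpose X + X = 0 \<and> J_mat ** X = X ** J_mat}"
  unfolding k_alg_def using lie_algebra_eq[of K_group "{mat 1}" "{J_mat}"] by (auto simp: K_group_eq)

lemma k_alg_subset: "k_alg \<subseteq> sp_alg"
  by (auto simp: k_alg_eq sp_alg_eq matrix_bilinear simp flip: eq_neg_iff_add_eq_0)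

section \<open>Diagonal matrices and the torus\<close>

definition idx :: "'n + 'n \<Rightarrow> 'n" where
  "idx = case_sum (\<lambda>a. a) (\<lambda>a. a)"

lemma idx_simps [simp]: "idx (Inl a) = a" "idx (Inr a) = a"
  by (simp_all add: idx_def)

definition diag_mat :: "('m \<Rightarrow> real) \<Rightarrow> real^'m^'m::finite" where
  "diag_mat f = (\<chi> i j. if i = j then f i else 0)"

lemma diag_mat_nth: "diag_mat f $ i $ j = (if i = j then f i else 0)"
  by (simp add: diag_mat_def)

lemma diag_mat_mult_nth: "(diag_mat f ** X) $ i $ j = f i * X $ i $ j"
  by (simp add: matrix_matrix_mult_def diag_mat_nth if_distrib[where f="\<lambda>x. x * _"] cong: if_cong)

lemma mult_diag_mat_nth: "(X ** diag_mat f) $ i $ j = X $ i $ j * f j"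
  by (simp add: matrix_matrix_mult_def diag_mat_nth if_distrib[where f="\<lambda>x. _ * x"] cong: if_cong)

lemma transpose_diag_mat: "transpose (diag_mat f) = diag_mat f"
  by (simp add: vec_eq_iff transpose_def diag_mat_nth)

text \<open>This is \<open>realify\<close> of a real diagonal matrix; its product with
  \<open>J_mat\<close>, which stands for \<open>\<i>\<close>, is the general element of
  \<open>t_alg\<close>.\<close>

definition dbl_diag :: "real^'n \<Rightarrow> 'n::finite sqmat" where
  "dbl_diag \<xi> = diag_mat (\<lambda>i. \<xi> $ idx i)"

lemmas dbl_diag_nth = diag_mat_nth[where f="\<lambda>i. _ $ idx i", folded dbl_diag_def]
lemmas dbl_diag_mult_nth = diag_mat_mult_nth[where f="\<lambda>i. _ $ idx i", folded dbl_diag_def]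
lemmas mult_dbl_diag_nth = mult_diag_mat_nth[where f="\<lambda>i. _ $ idx i", folded dbl_diag_def]
lemmas transpose_dbl_diag = transpose_diag_mat[where f="\<lambda>i. _ $ idx i", folded dbl_diag_def]

lemma J_dbl_diag_commute: "J_mat ** dbl_diag \<xi> = dbl_diag \<xi> ** J_mat"
  by (simp add: vec_eq_iff all_sum_iff mult_dbl_diag_nth dbl_diag_mult_nth)

lemma J_dbl_diag_nth_eq_0: "idx i \<noteq> idx j \<Longrightarrow> (J_mat ** dbl_diag \<xi>) $ i $ j = 0"
  by (cases i; cases j) (auto simp: dbl_diag_nth)

text \<open>The matrices \<open>dbl_diag (axis k 1)\<close> are the projections to the complex
  coordinate lines. Diagonality thus becomes a commutation condition, the shape that
  \<open>lie_algebra_eq\<close> requires of \<open>T_group\<close>.\<close>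

lemma commute_dbl_diag_axis_iff:
  "(\<forall>k. dbl_diag (axis k 1) ** M = M ** dbl_diag (axis k 1)) \<longleftrightarrow> (\<forall>i j. idx i \<noteq> idx j \<longrightarrow> M $ i $ j = 0)"
  unfolding vec_eq_iff[of "_ ** M"] vec_eq_iff[of "(_ ** M) $ _"]
  by (auto simp: dbl_diag_mult_nth mult_dbl_diag_nth axis_def)

lemma T_group_eq:
  "(T_group :: 'n::finite sqmat set) = {M. transpose M ** M = mat 1 \<and> J_mat ** M = M ** J_mat \<and>
     (\<forall>k. dbl_diag (axis k 1) ** M = M ** dbl_diag (axis k 1))}"
proof -
  have "(\<forall>i j. i \<noteq> j \<longrightarrow> U $ i $ j = 0) \<longleftrightarrow>
      (\<forall>k. dbl_diag (axis k 1) ** realify U = realify U ** dbl_diag (axis k 1))" for U :: "complex^'n^'n"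
    unfolding commute_dbl_diag_axis_iff by (auto simp: all_sum_iff complex_eq_iff)
  then have "T_group = K_group \<inter> {M :: 'n sqmat. \<forall>k. dbl_diag (axis k 1) ** M = M ** dbl_diag (axis k 1)}"
    unfolding T_group_def K_group_def by auto
  then show ?thesis by (auto simp: K_group_eq)
qed

lemma t_alg_eq: "(t_alg :: 'n::finite sqmat set) = range (\<lambda>h. J_mat ** dbl_diag h)"
proof -
  have "t_alg = {X :: 'n sqmat. transpose X + X = 0 \<and> J_mat ** X = X ** J_mat \<and>
      (\<forall>k. dbl_diag (axis k 1) ** X = X ** dbl_diag (axis k 1))}"
    unfolding t_alg_def
    using lie_algebra_eq[of T_group "{mat 1}" "insert J_mat (range (\<lambda>k. dbl_diag (axis k 1)))"]
    by (auto simp: T_group_eq)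
  also have "\<dots> = range (\<lambda>h. J_mat ** dbl_diag h)"
  proof (intro equalityI subsetI)
    fix X :: "'n sqmat"
    assume "X \<in> {X. transpose X + X = 0 \<and> J_mat ** X = X ** J_mat \<and>
      (\<forall>k. dbl_diag (axis k 1) ** X = X ** dbl_diag (axis k 1))}"
    then have X: "transpose X + X = 0" "X \<in> range realify" "\<And>i j. idx i \<noteq> idx j \<Longrightarrow> X $ i $ j = 0"
      unfolding commute_dbl_diag_axis_iff range_realify by auto
    from X(2) obtain U where U: "X = realify U" by auto
    have "(transpose X + X) $ Inl a $ Inl a = 0" for a using X(1) by simp
    then have Re0: "Re (U $ a $ a) = 0" for a by (simp add: transpose_def U)
    have U0: "U $ a $ b = 0" if "a \<noteq> b" for a b
      using that X(3)[of "Inl a" "Inl b"] X(3)[of "Inl a" "Inr b"] by (simp add: U complex_eq_iff)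
    have "Re (U $ a $ b) = 0" for a b using Re0[of a] U0[of a b] by (cases "a = b") auto
    with U0 have "X = J_mat ** dbl_diag (\<chi> a. Im (U $ a $ a))"
      by (auto simp: U vec_eq_iff all_sum_iff dbl_diag_nth)
    then show "X \<in> range (\<lambda>h. J_mat ** dbl_diag h)" by blast
  next
    fix X :: "'n sqmat" assume "X \<in> range (\<lambda>h. J_mat ** dbl_diag h)"
    then show "X \<in> {X. transpose X + X = 0 \<and> J_mat ** X = X ** J_mat \<and>
      (\<forall>k. dbl_diag (axis k 1) ** X = X ** dbl_diag (axis k 1))}"
      unfolding commute_dbl_diag_axis_iff
      by (auto simp: matrix_transpose_mul transpose_dbl_diag transpose_J_mat matrix_bilinear J_dbl_diag_nth_eq_0
          simp flip: matrix_mul_assoc J_dbl_diag_commute)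
  qed
  finally show ?thesis .
qed

lemma t_basis_eq: "t_basis k = J_mat ** dbl_diag (axis k 1)"
  by (auto simp: t_basis_def vec_eq_iff all_sum_iff dbl_diag_nth axis_def)

lemma t_alg_subset: "t_alg \<subseteq> sp_alg"
proof -
  have "T_group \<subseteq> K_group" by (auto simp: T_group_eq K_group_eq)
  then have "t_alg \<subseteq> k_alg" unfolding t_alg_def k_alg_def lie_algebra_def by blast
  then show ?thesis using k_alg_subset by blast
qed

section \<open>The Killing form and the moment map\<close>

lemma sp_alg_iff: "X \<in> sp_alg \<longleftrightarrow> transpose X ** J_mat = - (J_mat ** X)"
  by (simp add: sp_alg_eq eq_neg_iff_add_eq_0)

lemmas transpose_J_of_sp = sp_alg_iff[THEN iffD1]

text \<open>\<open>sp_alg\<close> is the fixed space of the involution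
  \<open>Z \<mapsto> J Z\<^sup>T J\<close>; averaging over this involution is the projection used
  for the Killing form.\<close>

lemma J_transpose_J_of_sp: "X \<in> sp_alg \<Longrightarrow> J_mat ** transpose X ** J_mat = X"
  by (simp add: transpose_J_of_sp matrix_bilinear flip: matrix_mul_assoc)

lemma subspace_sp_alg: "subspace sp_alg"
  by (rule subspaceI) (simp_all add: sp_alg_iff matrix_bilinear transpose_linear)

lemma ad_sp_alg: "X \<in> sp_alg \<Longrightarrow> Y \<in> sp_alg \<Longrightarrow> ad X Y \<in> sp_alg"
proof -
  assume X: "X \<in> sp_alg" and Y: "Y \<in> sp_alg"
  have "transpose (X ** Y) ** J_mat = J_mat ** (Y ** X)" if "X \<in> sp_alg" "Y \<in> sp_alg" for X Y :: "'a sqmat"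
  proof -
    have "transpose (X ** Y) ** J_mat = transpose Y ** (transpose X ** J_mat)"
      by (simp add: matrix_transpose_mul matrix_mul_assoc)
    also have "\<dots> = - (transpose Y ** J_mat) ** X"
      by (simp add: transpose_J_of_sp that matrix_bilinear matrix_mul_assoc)
    also have "\<dots> = J_mat ** (Y ** X)"
      by (simp add: transpose_J_of_sp that matrix_bilinear matrix_mul_assoc)
    finally show ?thesis .
  qed
  from this[OF X Y] this[OF Y X] show "ad X Y \<in> sp_alg"
    by (simp add: sp_alg_iff ad_def matrix_bilinear transpose_linear)
qed

lemma trace_of_sp:
  assumes "X \<in> sp_alg"
  shows "trace X = 0"
proof -
  have "trace X = trace (J_mat ** (J_mat ** transpose X))"
    using J_transpose_J_of_sp[OF assms] trace_mul_sym by metis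
  also have "\<dots> = - trace X" by (simp add: trace_def transpose_def sum_negf)
  finally show ?thesis by simp
qed

lemma trace_uminus: "trace (- A :: real^'m::finite^'m) = - trace A"
  by (simp add: trace_def sum_negf)

lemma trace_scaleR: "trace (c *\<^sub>R A :: real^'m::finite^'m) = c * trace A"
  by (simp add: trace_def sum_distrib_left)

text \<open>The trace over \<open>sp_alg\<close> is computed on all matrices, precomposing with the projection
  \<open>Z \<mapsto> (Z + J Z\<^sup>T J) / 2\<close> onto \<open>sp_alg\<close>.\<close>

lemma killing_eq:
  fixes X Y :: "'n::finite sqmat"
  assumes X: "X \<in> sp_alg" and Y: "Y \<in> sp_alg"
  shows "killing X Y = (2 * real CARD('n) + 2) * trace (X ** Y)"
proof -
  define P where "P Z = (1/2) *\<^sub>R (Z + J_mat ** transpose Z ** J_mat)" for Z :: "'n sqmat"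
  have "killing X Y = (\<Sum>u\<in>Basis. (ad X \<circ> ad Y) (P u) \<bullet> u)"
    unfolding killing_def
  proof (rule trace_on_eq[OF subspace_sp_alg])
    show "linear (ad X \<circ> ad Y)"
      by (intro linear_compose linearI) (simp_all add: ad_def matrix_bilinear algebra_simps)
    show "linear P"
      by (intro linearI) (simp_all add: P_def matrix_bilinear transpose_linear algebra_simps)
    fix x :: "'n sqmat"
    show "(ad X \<circ> ad Y) x \<in> sp_alg" if "x \<in> sp_alg" using that X Y by (simp add: ad_sp_alg)
    show "P x = x" if "x \<in> sp_alg"
      using that by (simp add: P_def J_transpose_J_of_sp flip: scaleR_2)
    show "P x \<in> sp_alg"
      by (simp add: sp_alg_eq P_def matrix_bilinear transpose_linear matrix_transpose_mul transpose_J_mat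
          flip: matrix_mul_assoc scaleR_add_right)
        (simp add: matrix_mul_assoc matrix_bilinear)
  qed
  \<comment> \<open>Each of the eight terms is brought to the form \<open>A u B\<close> or
    \<open>A u\<^sup>T B\<close>, with \<open>mat 1\<close> inserted where a factor is absent, so
    that the two trace formulas apply termwise.\<close>
  moreover have "(ad X \<circ> ad Y) (P u) = (1/2) *\<^sub>R
      (X ** Y ** u ** mat 1 - X ** u ** Y - Y ** u ** X + mat 1 ** u ** (Y ** X)
      + (X ** Y ** J_mat) ** transpose u ** J_mat - (X ** J_mat) ** transpose u ** (J_mat ** Y)
      - (Y ** J_mat) ** transpose u ** (J_mat ** X) + J_mat ** transpose u ** (J_mat ** Y ** X))" for u
    by (simp add: P_def ad_def matrix_bilinear matrix_mul_assoc algebra_simps)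
  ultimately have kill: "killing X Y = (1/2) *
     (trace (X ** Y) * trace (mat 1 :: 'n sqmat) - trace X * trace Y - trace Y * trace X
      + trace (mat 1 :: 'n sqmat) * trace (Y ** X)
      + trace (X ** Y ** J_mat ** transpose J_mat) - trace (X ** J_mat ** transpose (J_mat ** Y))
      - trace (Y ** J_mat ** transpose (J_mat ** X)) + trace (J_mat ** transpose (J_mat ** Y ** X)))"
    by (simp only: inner_scaleR_left inner_add_left inner_diff_left sum.distrib sum_subtractf
        sum_distrib_left[symmetric] sum_Basis_mult sum_Basis_mult_transpose)
  have 1: "X ** Y ** J_mat ** transpose J_mat = X ** Y"
    by (simp add: transpose_J_mat matrix_bilinear)
  have 2: "X ** J_mat ** transpose (J_mat ** Y) = - (X ** Y)"
    using J_transpose_J_of_sp[OF Y]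
    by (simp add: matrix_transpose_mul transpose_J_mat matrix_bilinear flip: matrix_mul_assoc)
  have 3: "Y ** J_mat ** transpose (J_mat ** X) = - (Y ** X)"
    using J_transpose_J_of_sp[OF X]
    by (simp add: matrix_transpose_mul transpose_J_mat matrix_bilinear flip: matrix_mul_assoc)
  have 4: "J_mat ** transpose (J_mat ** Y ** X) = X ** Y"
  proof -
    have "J_mat ** transpose (J_mat ** Y ** X) = - (J_mat ** transpose X ** (transpose Y ** J_mat))"
      by (simp add: matrix_transpose_mul transpose_J_mat matrix_bilinear matrix_mul_assoc)
    also have "\<dots> = (J_mat ** transpose X ** J_mat) ** Y"
      by (simp add: transpose_J_of_sp[OF Y] matrix_bilinear matrix_mul_assoc)
    finally show ?thesis by (simp add: J_transpose_J_of_sp[OF X])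
  qed
  \<comment> \<open>The plain terms contribute \<open>2n tr(XY)\<close>, because
    \<open>mat 1\<close> has trace \<open>2n\<close> and elements of \<open>sp_alg\<close> are
    traceless; the four transposed terms contribute \<open>2 tr(XY)\<close>.\<close>
  show ?thesis unfolding kill 1 2 3 4
    by (simp add: trace_of_sp X Y trace_uminus trace_I trace_mul_sym[of Y X] algebra_simps)
qed

lemma trace_J_dbl_diag:
  "trace ((J_mat ** dbl_diag h) ** (J_mat ** dbl_diag k)) = - 2 * (h \<bullet> k)"
proof -
  have "(J_mat ** dbl_diag h) ** (J_mat ** dbl_diag k) = - (dbl_diag h ** dbl_diag k)"
    by (simp add: J_dbl_diag_commute[of h] matrix_bilinear flip: matrix_mul_assoc)
  then show ?thesis
    by (simp add: trace_def dbl_diag_mult_nth dbl_diag_nth sum_negf sum_UNIV_Plus inner_vec_def)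
qed

text \<open>The vectors \<open>t_basis k\<close> are orthogonal for the Killing form, each with
  square \<open>(2n + 2) * (- 2)\<close>. Its inverse is the scalar in front.\<close>

lemma killing_dual_eq:
  fixes \<xi> :: "real^'n::finite"
  shows "killing_dual \<xi> = (- 1 / (4 * real CARD('n) + 4)) *\<^sub>R (J_mat ** dbl_diag \<xi>)"
proof -
  define c where "c = 4 * real CARD('n) + 4"
  have kill: "killing (J_mat ** dbl_diag h) (t_basis k) = - c * h $ k" for h :: "real^'n" and k
  proof -
    have "J_mat ** dbl_diag h \<in> t_alg" "t_basis k \<in> t_alg"
      by (auto simp: t_alg_eq t_basis_eq)
    then have "J_mat ** dbl_diag h \<in> sp_alg" "t_basis k \<in> sp_alg"
      using t_alg_subset by blast+
    from killing_eq[OF this] show ?thesis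
      by (simp add: t_basis_eq trace_J_dbl_diag inner_axis c_def algebra_simps)
  qed
  have c: "c > 0" by (simp add: c_def)
  have scale: "(- 1 / c) *\<^sub>R (J_mat ** dbl_diag \<xi>) = J_mat ** dbl_diag ((- 1 / c) *\<^sub>R \<xi>)"
    by (auto simp: vec_eq_iff all_sum_iff dbl_diag_nth)
  show ?thesis
    unfolding killing_dual_def c_def[symmetric] scale
  proof (rule the_equality)
    show "J_mat ** dbl_diag ((- 1 / c) *\<^sub>R \<xi>) \<in> t_alg \<and>
        (\<forall>k. killing (J_mat ** dbl_diag ((- 1 / c) *\<^sub>R \<xi>)) (t_basis k) = \<xi> $ k)"
      unfolding kill using c by (auto simp: t_alg_eq)
    fix H :: "'n sqmat" assume H: "H \<in> t_alg \<and> (\<forall>k. killing H (t_basis k) = \<xi> $ k)"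
    then obtain h where h: "H = J_mat ** dbl_diag h" by (auto simp: t_alg_eq)
    then have "- c * h $ k = \<xi> $ k" for k using H kill[of h k] by metis
    then have "\<xi> = (- c) *\<^sub>R h" by (auto simp: vec_eq_iff)
    then have "h = (- 1 / c) *\<^sub>R \<xi>" using c by simp
    then show "H = J_mat ** dbl_diag ((- 1 / c) *\<^sub>R \<xi>)" by (simp add: h)
  qed
qed

section \<open>Inverses in \<open>Sp\<close> and the coadjoint action\<close>

lemma matrix_inv_right:
  assumes "invertible A"
  shows "A ** matrix_inv A = mat 1"
  using someI_ex[OF assms[unfolded invertible_def]] unfolding matrix_inv_def by blast

lemma matrix_inv_Sp:
  assumes "M \<in> Sp"
  shows "matrix_inv M = - (J_mat ** transpose M ** J_mat)"
proof -
  let ?N = "- (J_mat ** transpose M ** J_mat)"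
  have N: "?N ** M = mat 1"
    using assms by (simp add: Sp_eq matrix_bilinear J_mat_square flip: matrix_mul_assoc)
  have "matrix_inv M = (?N ** M) ** matrix_inv M" by (simp only: N matrix_mul_lid)
  also have "\<dots> = ?N ** (M ** matrix_inv M)" by (simp only: matrix_mul_assoc)
  also have "\<dots> = ?N" using assms by (simp add: Sp_def matrix_inv_right)
  finally show ?thesis .
qed

text \<open>\<open>Sp\<close> is closed under transposition, since a left inverse is also a right
  inverse. The inequality argument below works with the transpose of \<open>M\<close>.\<close>

lemma transpose_Sp:
  assumes "M \<in> Sp"
  shows "M ** J_mat ** transpose M = J_mat"
proof -
  have "M ** matrix_inv M = mat 1" using assms by (simp add: Sp_def matrix_inv_right)
  then have "- (M ** J_mat ** transpose M ** J_mat) = mat 1"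
    by (simp add: matrix_inv_Sp[OF assms] matrix_bilinear matrix_mul_assoc)
  then have "- (M ** J_mat ** transpose M ** J_mat) ** J_mat = J_mat" by simp
  then show ?thesis by (simp add: matrix_bilinear)
qed

lemma conjugate_sp_alg:
  assumes M: "M \<in> Sp" and X: "X \<in> sp_alg"
  shows "matrix_inv M ** X ** M \<in> sp_alg"
proof -
  have "transpose (matrix_inv M) ** J_mat = J_mat ** M"
    by (simp add: matrix_inv_Sp[OF M] transpose_linear matrix_transpose_mul transpose_J_mat matrix_bilinear
        matrix_mul_assoc)
  then have "transpose (matrix_inv M ** X ** M) ** J_mat = transpose M ** transpose X ** (J_mat ** M)"
    by (simp add: matrix_transpose_mul flip: matrix_mul_assoc)
  also have "\<dots> = transpose M ** (transpose X ** J_mat) ** M"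
    by (simp add: matrix_mul_assoc)
  also have "\<dots> = - (J_mat ** (matrix_inv M ** X ** M))"
    by (simp add: transpose_J_of_sp[OF X] matrix_inv_Sp[OF M] matrix_bilinear flip: matrix_mul_assoc)
  finally show ?thesis by (simp add: sp_alg_iff)
qed

text \<open>Substituting \<open>S = J X\<close>, the condition that the moment map of \<open>K\<close> takes the value \<open>\<mu>\<close> at
  \<open>M \<cdot> \<Lambda>\<close> says that \<open>M D\<^sub>\<Lambda> M\<^sup>T\<close> and \<open>D\<^sub>\<mu>\<close> have the same trace pairing with every
  symmetric \<open>S\<close> commuting with \<open>J\<close>.\<close>

lemma mem_Delta_K_iff:
  fixes \<Lambda> \<mu> :: "(real, 'n::{finite,linorder}) vec"
  shows "\<mu> \<in> Delta_K (coadjoint_orbit \<Lambda>) \<longleftrightarrow> \<mu> \<in> dominant \<and>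
    (\<exists>M\<in>Sp. \<forall>S. transpose S = S \<and> J_mat ** S = S ** J_mat \<longrightarrow>
      trace (dbl_diag \<Lambda> ** (transpose M ** S ** M)) = trace (dbl_diag \<mu> ** S))"
proof -
  let ?c = "4 * real CARD('n) + 4"
  have kill: "killing (killing_dual \<xi>) X = - (1/2) * trace (dbl_diag \<xi> ** (J_mat ** X))"
    if "X \<in> sp_alg" for \<xi> :: "(real, 'n) vec" and X
  proof -
    have "killing_dual \<xi> \<in> t_alg"
      unfolding killing_dual_eq t_alg_eq
      by (rule range_eqI[of _ _ "(- 1 / ?c) *\<^sub>R \<xi>"]) (auto simp: vec_eq_iff all_sum_iff dbl_diag_nth)
    then have "killing_dual \<xi> \<in> sp_alg" using t_alg_subset by blast
    note killing_eq[OF this that]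
    also have "killing_dual \<xi> ** X = (- 1 / ?c) *\<^sub>R (dbl_diag \<xi> ** (J_mat ** X))"
      unfolding killing_dual_eq J_dbl_diag_commute by (simp only: matrix_bilinear matrix_mul_assoc)
    finally have "killing (killing_dual \<xi>) X =
        ((2 * real CARD('n) + 2) * (- 1 / ?c)) * trace (dbl_diag \<xi> ** (J_mat ** X))"
      by (simp only: trace_scaleR mult.assoc)
    also have "(2 * real CARD('n) + 2) * (- 1 / ?c) = - (1/2)" by (simp add: field_simps)
    finally show ?thesis .
  qed
  \<comment> \<open>Since \<open>J M\<^sup>-\<^sup>1 = M\<^sup>T J\<close>, conjugation of
    \<open>X\<close> becomes congruence of \<open>J X\<close>.\<close>
  have orb: "J_mat ** (matrix_inv M ** X ** M) = transpose M ** (J_mat ** X) ** M" if "M \<in> Sp"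
    for M X :: "'n sqmat"
  proof -
    have "J_mat ** matrix_inv M = transpose M ** J_mat"
      by (simp add: matrix_inv_Sp[OF that] matrix_bilinear flip: matrix_mul_assoc)
    then show ?thesis by (simp add: matrix_mul_assoc)
  qed
  have "to_k_dual \<mu> = restrict (coadjoint M (to_g_dual \<Lambda>)) k_alg \<longleftrightarrow>
      (\<forall>S. transpose S = S \<and> J_mat ** S = S ** J_mat \<longrightarrow>
      trace (dbl_diag \<Lambda> ** (transpose M ** S ** M)) = trace (dbl_diag \<mu> ** S))" if M: "M \<in> Sp" for M
  proof -
    have "to_k_dual \<mu> = restrict (coadjoint M (to_g_dual \<Lambda>)) k_alg \<longleftrightarrow>
      (\<forall>X\<in>k_alg. killing (killing_dual \<mu>) X = killing (killing_dual \<Lambda>) (matrix_inv M ** X ** M))"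
    proof -
      have "coadjoint M (to_g_dual \<Lambda>) X = killing (killing_dual \<Lambda>) (matrix_inv M ** X ** M)"
        if "X \<in> k_alg" for X
        using that k_alg_subset conjugate_sp_alg[OF M, of X]
        by (auto simp: coadjoint_def to_g_dual_def)
      then show ?thesis
        unfolding to_k_dual_def fun_eq_iff restrict_def by metis
    qed
    also have "\<dots> \<longleftrightarrow> (\<forall>X\<in>k_alg. trace (dbl_diag \<Lambda> ** (transpose M ** (J_mat ** X) ** M))
        = trace (dbl_diag \<mu> ** (J_mat ** X)))"
    proof (intro ball_cong refl)
      fix X :: "'n sqmat" assume "X \<in> k_alg"
      then have X: "X \<in> sp_alg" using k_alg_subset by blast
      show "killing (killing_dual \<mu>) X = killing (killing_dual \<Lambda>) (matrix_inv M ** X ** M) \<longleftrightarrow>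
        trace (dbl_diag \<Lambda> ** (transpose M ** (J_mat ** X) ** M)) = trace (dbl_diag \<mu> ** (J_mat ** X))"
        unfolding kill[OF X] kill[OF conjugate_sp_alg[OF M X]] orb[OF M] by linarith
    qed
    also have "\<dots> \<longleftrightarrow> (\<forall>S. transpose S = S \<and> J_mat ** S = S ** J_mat \<longrightarrow>
      trace (dbl_diag \<Lambda> ** (transpose M ** S ** M)) = trace (dbl_diag \<mu> ** S))"
    proof (intro iffI allI impI ballI)
      fix S :: "'n sqmat" assume *: "\<forall>X\<in>k_alg. trace (dbl_diag \<Lambda> ** (transpose M ** (J_mat ** X) ** M))
        = trace (dbl_diag \<mu> ** (J_mat ** X))"
        and S: "transpose S = S \<and> J_mat ** S = S ** J_mat"
      \<comment> \<open>The preimage of \<open>S\<close> under \<open>X \<mapsto> J X\<close> is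
        \<open>- J S\<close>.\<close>
      have "transpose (- (J_mat ** S)) = J_mat ** S"
        using S by (simp add: transpose_linear matrix_transpose_mul transpose_J_mat matrix_bilinear)
      moreover have JS: "J_mat ** - (J_mat ** S) = S" by (simp add: matrix_bilinear)
      moreover have "- (J_mat ** S) ** J_mat = S" using S by (simp add: matrix_bilinear)
      ultimately have "- (J_mat ** S) \<in> k_alg" by (simp add: k_alg_eq)
      from *[rule_format, OF this]
      show "trace (dbl_diag \<Lambda> ** (transpose M ** S ** M)) = trace (dbl_diag \<mu> ** S)"
        unfolding JS .
    next
      fix X :: "'n sqmat" assume *: "\<forall>S. transpose S = S \<and> J_mat ** S = S ** J_mat \<longrightarrow>
        trace (dbl_diag \<Lambda> ** (transpose M ** S ** M)) = trace (dbl_diag \<mu> ** S)" and X: "X \<in> k_alg"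
      from X have tX: "transpose X = - X" and JX: "J_mat ** X = X ** J_mat"
        by (auto simp: k_alg_eq eq_neg_iff_add_eq_0)
      have "transpose (J_mat ** X) = J_mat ** X"
        using tX JX by (simp add: matrix_transpose_mul transpose_J_mat matrix_bilinear)
      moreover have "J_mat ** (J_mat ** X) = (J_mat ** X) ** J_mat"
        using JX by (metis J_J_mult)
      ultimately show "trace (dbl_diag \<Lambda> ** (transpose M ** (J_mat ** X) ** M))
        = trace (dbl_diag \<mu> ** (J_mat ** X))" by (intro *[rule_format] conjI)
    qed
    finally show ?thesis .
  qed
  then show ?thesis
    unfolding Delta_K_def coadjoint_orbit_def image_image image_iff mem_Collect_eq
    by (intro conj_cong bex_cong refl)
qed

section \<open>Inequalities for the moment polyhedron\<close>

definition weighted_sq :: "real^'n \<Rightarrow> real^('n + 'n) \<Rightarrow> real" where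
  "weighted_sq \<xi> x = (\<Sum>i\<in>(UNIV :: ('n::finite + 'n) set). \<xi> $ idx i * (x $ i)\<^sup>2)"

text \<open>Rank-one test matrices turn the trace identities into identities between quadratic
  forms.\<close>

definition outer :: "real^'m \<Rightarrow> real^'m^'m::finite" where
  "outer x = (\<chi> i j. x $ i * x $ j)"

lemma outer_matrix_vector_mult: "A ** outer x ** transpose A = outer (A *v x)"
  by (simp add: vec_eq_iff outer_def matrix_matrix_mult_def transpose_def matrix_vector_mult_def
      sum_distrib_left sum_distrib_right mult_ac sum_product)

lemma trace_dbl_diag_outer: "trace (dbl_diag \<xi> ** outer x) = weighted_sq \<xi> x"
  by (simp add: trace_def dbl_diag_mult_nth outer_def weighted_sq_def power2_eq_square)

lemma J_vector_nth [simp]: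
  "(J_mat *v x) $ Inl a = x $ Inr a" "(J_mat *v x) $ Inr a = - x $ Inl a"
  by (simp_all add: matrix_vector_mult_def sum_UNIV_Plus if_distrib[where f="\<lambda>x. x * _"] sum_negf
      cong: if_cong)

lemma J_J_vector: "J_mat *v (J_mat *v x) = - x"
  by (simp add: vec_eq_iff all_sum_iff)

lemma weighted_sq_J: "weighted_sq \<xi> (J_mat *v x) = weighted_sq \<xi> x"
  by (simp add: weighted_sq_def sum_UNIV_Plus)

lemma weighted_sq_parallelogram:
  "weighted_sq \<xi> (u + w) + weighted_sq \<xi> (u - w) = 2 * (weighted_sq \<xi> u + weighted_sq \<xi> w)"
  by (simp add: weighted_sq_def sum_distrib_left power2_eq_square algebra_simps flip: sum.distrib)

lemma weighted_sq_nonneg: "(\<And>k. \<xi> $ k \<ge> 0) \<Longrightarrow> weighted_sq \<xi> x \<ge> 0"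
  unfolding weighted_sq_def by (intro sum_nonneg) simp

lemma inner_eq_sum_squares: "x \<bullet> x = (\<Sum>i\<in>UNIV. (x $ i)\<^sup>2)" for x :: "real^'m::finite"
  by (simp add: inner_vec_def power2_eq_square)

text \<open>With \<open>N = M\<^sup>T\<close>, the vectors \<open>u\<close> and \<open>w\<close> are the images of \<open>x\<close> under the parts of \<open>N\<close> that
  commute and anticommute with \<open>J\<close>. They are the Bogoliubov coefficients of \<open>N\<close>, whence the
  indefinite norm identity. Choosing \<open>x\<close> in the kernel of a square system with a missing equation
  plays the role of the dimension count in Courant-Fischer.\<close>

lemma le_of_averaged_trace:
  fixes \<Lambda> \<mu> :: "(real, 'n::{finite,linorder}) vec"
  assumes \<Lambda>: "\<Lambda> \<in> dominant" "\<And>k. \<Lambda> $ k > 0" and \<mu>: "\<mu> \<in> dominant" and M: "M \<in> Sp"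
    and tr: "\<And>S. transpose S = S \<Longrightarrow> J_mat ** S = S ** J_mat \<Longrightarrow>
      trace (dbl_diag \<Lambda> ** (transpose M ** S ** M)) = trace (dbl_diag \<mu> ** S)"
  shows "\<Lambda> $ m \<le> \<mu> $ m"
proof -
  define N where "N = transpose M"
  define u where "u x = (1/2) *\<^sub>R (N *v x - J_mat *v (N *v (J_mat *v x)))" for x
  define w where "w x = (1/2) *\<^sub>R (N *v x + J_mat *v (N *v (J_mat *v x)))" for x
  have N: "transpose N ** J_mat ** N = J_mat" using transpose_Sp[OF M] by (simp add: N_def)
  have Nx: "N *v x = u x + w x" for x
    by (simp add: u_def w_def vec_eq_iff field_simps)
  have JNJx: "J_mat *v (N *v (J_mat *v x)) = w x - u x" for x
    by (simp add: u_def w_def vec_eq_iff field_simps)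
  have q: "weighted_sq \<mu> x = weighted_sq \<Lambda> (u x) + weighted_sq \<Lambda> (w x)" for x
  proof -
    \<comment> \<open>Conjugation by \<open>J\<close> exchanges the two summands, so their sum is an
      admissible test matrix. It yields the values of \<open>weighted_sq \<Lambda>\<close> at
      \<open>u + w\<close> and \<open>u - w\<close>, and the parallelogram law removes the cross
      terms.\<close>
    let ?S = "outer x + outer (J_mat *v x)"
    have "transpose ?S = ?S" by (simp add: vec_eq_iff outer_def transpose_def mult.commute)
    moreover have "J_mat ** ?S = ?S ** J_mat"
      by (simp add: vec_eq_iff all_sum_iff outer_def)
    ultimately have "trace (dbl_diag \<Lambda> ** (N ** ?S ** transpose N)) = trace (dbl_diag \<mu> ** ?S)"
      using tr[of ?S] by (simp add: N_def)
    then have "weighted_sq \<Lambda> (N *v x) + weighted_sq \<Lambda> (N *v (J_mat *v x)) = 2 * weighted_sq \<mu> x"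
      by (simp add: matrix_bilinear outer_matrix_vector_mult trace_add trace_dbl_diag_outer weighted_sq_J)
    moreover have "weighted_sq \<Lambda> (N *v (J_mat *v x)) = weighted_sq \<Lambda> (u x - w x)"
      using weighted_sq_J[of \<Lambda> "N *v (J_mat *v x)"]
      by (simp add: JNJx weighted_sq_def power2_commute)
    ultimately show ?thesis
      using weighted_sq_parallelogram[of \<Lambda> "u x" "w x"] by (simp add: Nx)
  qed
  have nrm: "x \<bullet> x = u x \<bullet> u x - w x \<bullet> w x" for x
  proof -
    \<comment> \<open>The left side is \<open>(u + w) \<bullet> (w - u)\<close>, while
      \<open>N\<^sup>T J N = J\<close> reduces the right side to
      \<open>x \<bullet> J J x\<close>.\<close>
    have "(N *v x) \<bullet> (J_mat *v (N *v (J_mat *v x))) = x \<bullet> ((transpose N ** J_mat ** N) *v (J_mat *v x))"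
      by (simp add: dot_lmul_matrix matrix_vector_mul_assoc[symmetric] del: transpose_matrix_vector)
        (metis dot_lmul_matrix transpose_matrix_vector inner_commute)
    also have "\<dots> = - (x \<bullet> x)" by (simp only: N J_J_vector inner_minus_right)
    finally have "(N *v x) \<bullet> (w x - u x) = - (x \<bullet> x)" unfolding JNJx .
    then show ?thesis by (simp add: Nx algebra_simps inner_commute)
  qed
  \<comment> \<open>The two components of index \<open>m\<close> are zero, so \<open>F\<close> is
    singular. A kernel vector \<open>x\<close> lives on indices at least \<open>m\<close>, where
    \<open>\<mu>\<close> is at most \<open>\<mu> $ m\<close>, and \<open>u x\<close> lives on
    indices at most \<open>m\<close>, where \<open>\<Lambda>\<close> is at least
    \<open>\<Lambda> $ m\<close>.\<close>
  define F where "F x = (\<chi> i. if idx i < m then x $ i else if m < idx i then u x $ i else 0)" for x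
  have "linear F"
    by (intro linearI)
      (auto simp: F_def u_def vec_eq_iff matrix_vector_right_distrib scaleR_vector_matrix_assoc
        matrix_vector_mult_scaleR algebra_simps)
  moreover have "\<not> surj F"
  proof
    assume "surj F"
    then obtain x where "F x = axis (Inl m) 1" by (metis surjD)
    then have "F x $ Inl m = 1" by simp
    then show False by (simp add: F_def)
  qed
  ultimately have "\<not> inj F" using linear_injective_imp_surjective by blast
  then obtain x where x: "F x = 0" "x \<noteq> 0"
    using linear_injective_0[OF \<open>linear F\<close>] by blast
  have F0: "F x $ i = 0" for i using x(1) by simp
  have 1: "weighted_sq \<mu> x \<le> \<mu> $ m * (x \<bullet> x)"
    unfolding weighted_sq_def inner_eq_sum_squares sum_distrib_left
  proof (rule sum_mono)
    fix i
    show "\<mu> $ idx i * (x $ i)\<^sup>2 \<le> \<mu> $ m * (x $ i)\<^sup>2"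
      using F0[of i] \<mu> by (cases "idx i < m") (auto simp: F_def dominant_def intro!: mult_right_mono)
  qed
  have 2: "\<Lambda> $ m * (u x \<bullet> u x) \<le> weighted_sq \<Lambda> (u x)"
    unfolding weighted_sq_def inner_eq_sum_squares sum_distrib_left
  proof (rule sum_mono)
    fix i
    have "u x $ i = 0" if "m < idx i"
    proof -
      have "\<not> idx i < m" using that by (simp add: not_less)
      then show ?thesis using F0[of i] that by (simp add: F_def)
    qed
    then show "\<Lambda> $ m * (u x $ i)\<^sup>2 \<le> \<Lambda> $ idx i * (u x $ i)\<^sup>2"
      using \<Lambda>(1) by (cases "m < idx i") (auto simp: dominant_def intro!: mult_right_mono)
  qed
  \<comment> \<open>The contributions of \<open>w x\<close> to the norm identity and to
    \<open>q\<close> both have the favourable sign, as \<open>\<Lambda>\<close> is positive.\<close>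
  have "\<Lambda> $ m * (x \<bullet> x) \<le> \<Lambda> $ m * (u x \<bullet> u x)"
    using \<Lambda>(2)[of m] nrm[of x] inner_ge_zero[of "w x"] by (intro mult_left_mono) auto
  also note 2
  also have "weighted_sq \<Lambda> (u x) \<le> weighted_sq \<mu> x"
    using weighted_sq_nonneg[of \<Lambda> "w x"] \<Lambda>(2) q[of x] by (simp add: less_imp_le)
  also note 1
  finally show ?thesis using x(2) by simp
qed

text \<open>Already a diagonal symplectic matrix reaches \<open>\<mu>\<close>: \<open>(t\<^sup>2 + t\<^sup>-\<^sup>2) / 2\<close> takes every value \<open>\<ge> 1\<close>.\<close>

lemma mem_Delta_K_of_le:
  fixes \<Lambda> \<mu> :: "(real, 'n::{finite,linorder}) vec"
  assumes \<Lambda>: "\<And>k. \<Lambda> $ k > 0" and le: "\<And>k. \<Lambda> $ k \<le> \<mu> $ k" and \<mu>: "\<mu> \<in> dominant"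
  shows "\<mu> \<in> Delta_K (coadjoint_orbit \<Lambda>)"
proof -
  have "\<exists>t>0. \<Lambda> $ k * (t\<^sup>2 + (1 / t)\<^sup>2) = 2 * \<mu> $ k" for k
  proof -
    define c where "c = \<mu> $ k / \<Lambda> $ k"
    \<comment> \<open>The larger root of \<open>s\<^sup>2 - 2 c s + 1 = 0\<close>, that is of
      \<open>s + 1/s = 2 c\<close>; its square root is the required \<open>t\<close>.\<close>
    define s where "s = c + sqrt (c\<^sup>2 - 1)"
    have c: "c \<ge> 1" using \<Lambda>[of k] le[of k] by (simp add: c_def)
    then have s: "s > 0" by (simp add: s_def add_pos_nonneg)
    have "(sqrt (c\<^sup>2 - 1))\<^sup>2 = c\<^sup>2 - 1" using c by simp
    then have "s * (c - sqrt (c\<^sup>2 - 1)) = 1"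
      by (simp add: s_def power2_eq_square algebra_simps)
    then have "1 / s = c - sqrt (c\<^sup>2 - 1)" using s by (simp add: field_simps)
    then have "s + 1 / s = 2 * c" by (simp add: s_def)
    then have "\<Lambda> $ k * ((sqrt s)\<^sup>2 + (1 / sqrt s)\<^sup>2) = 2 * \<mu> $ k"
      using s \<Lambda>[of k] by (simp add: c_def power_divide)
    then show ?thesis using s by (intro exI[of _ "sqrt s"]) simp
  qed
  then obtain t where t: "\<And>k. t k > 0" "\<And>k. \<Lambda> $ k * ((t k)\<^sup>2 + (1 / t k)\<^sup>2) = 2 * \<mu> $ k"
    by metis
  define d where "d = case_sum t (\<lambda>k. 1 / t k)"
  define M where "M = diag_mat d"
  have tne: "t k \<noteq> 0" for k using t(1)[of k] by simp
  have "M \<in> Sp"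
    by (auto simp: Sp_eq transpose_diag_mat vec_eq_iff all_sum_iff M_def mult_diag_mat_nth diag_mat_mult_nth diag_mat_nth d_def tne)
  moreover have "trace (dbl_diag \<Lambda> ** (transpose M ** S ** M)) = trace (dbl_diag \<mu> ** S)"
    if S: "J_mat ** S = S ** J_mat" for S
  proof -
    \<comment> \<open>Commuting with \<open>J\<close> equates the two diagonal entries of
      \<open>S\<close> at \<open>k\<close>, so only the sum of the factors
      \<open>(t k)\<^sup>2\<close> and \<open>(1 / t k)\<^sup>2\<close> matters.\<close>
    have "(J_mat ** S) $ Inl k $ Inr k = (S ** J_mat) $ Inl k $ Inr k" for k using S by simp
    then have eq: "S $ Inr k $ Inr k = S $ Inl k $ Inl k" for k by simp
    have "\<Lambda> $ k * (t k * S $ Inl k $ Inl k * t k) + \<Lambda> $ k * (S $ Inl k $ Inl k / t k / t k)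
        = 2 * (\<mu> $ k * S $ Inl k $ Inl k)" for k
      unfolding mult.assoc[symmetric] t(2)[symmetric] by (simp add: power2_eq_square algebra_simps)
    then show ?thesis
      by (simp add: trace_def sum_UNIV_Plus dbl_diag_mult_nth M_def transpose_diag_mat mult_diag_mat_nth diag_mat_mult_nth
          d_def eq flip: sum.distrib)
  qed
  ultimately show ?thesis unfolding mem_Delta_K_iff using \<mu> by blast
qed

lemma mem_Delta_K_iff_le:
  fixes \<Lambda> \<mu> :: "(real, 'n::{finite,linorder}) vec"
  assumes "\<Lambda> \<in> dominant" "\<And>k. \<Lambda> $ k > 0"
  shows "\<mu> \<in> Delta_K (coadjoint_orbit \<Lambda>) \<longleftrightarrow> \<mu> \<in> dominant \<and> (\<forall>k. \<Lambda> $ k \<le> \<mu> $ k)"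
  using le_of_averaged_trace[OF assms] mem_Delta_K_of_le[OF assms(2)] mem_Delta_K_iff by metis

section \<open>Horn inequalities, the cone and the polyhedron\<close>

lemma bij_betw_nth_elem:
  fixes A :: "'a::linorder set"
  assumes "finite A"
  shows "bij_betw (nth_elem A) {1..card A} A"
proof -
  have "bij_betw ((!) (sorted_list_of_set A)) {..<card A} A"
    using assms by (intro bij_betw_nth) auto
  moreover have "bij_betw (\<lambda>k. k - 1) {1..card A} {..<card A}"
    by (rule bij_betw_byWitness[where f' = Suc]) auto
  ultimately show ?thesis
    using bij_betw_trans by (fastforce simp: nth_elem_def[abs_def] o_def)
qed

lemma nth_elem_mono:
  fixes A :: "'a::linorder set"
  assumes "1 \<le> i" "i \<le> j" "j \<le> card A"
  shows "nth_elem A i \<le> nth_elem A j"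
  unfolding nth_elem_def using assms by (intro sorted_nth_mono) auto

lemma nth_elem_singleton: "nth_elem {a} (Suc 0) = a"
  by (simp add: nth_elem_def)

text \<open>Counting predecessors inverts the enumeration; \<open>dual_weight\<close> recovers
  positions in this way.\<close>

lemma card_atMost_nth_elem:
  assumes "1 \<le> j" "j \<le> CARD('n)"
  shows "card {..nth_elem (UNIV :: 'n::{finite,linorder} set) j} = j"
proof -
  let ?e = "nth_elem (UNIV :: 'n set)"
  have bij: "bij_betw ?e {1..CARD('n)} UNIV" by (rule bij_betw_nth_elem) simp
  have "{..?e j} = ?e ` {1..j}"
  proof (intro equalityI subsetI)
    fix x assume x: "x \<in> {..?e j}"
    obtain i where i: "i \<in> {1..CARD('n)}" "x = ?e i" using bij unfolding bij_betw_def by blast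
    have "i \<le> j"
    proof (rule ccontr)
      assume "\<not> i \<le> j"
      then have "?e j \<le> ?e i" using assms i by (intro nth_elem_mono) auto
      then have "?e j = ?e i" using x i by auto
      moreover have "j \<in> {1..CARD('n)}" using assms by simp
      ultimately have "j = i" using i(1) inj_onD[OF bij_betw_imp_inj_on[OF bij]] by blast
      then show False using \<open>\<not> i \<le> j\<close> by simp
    qed
    then show "x \<in> ?e ` {1..j}" using i by auto
  qed (use assms in \<open>auto intro: nth_elem_mono\<close>)
  moreover have "inj_on ?e {1..j}"
    using bij assms unfolding bij_betw_def by (auto intro: inj_on_subset)
  ultimately show ?thesis by (simp add: card_image)
qed

lemma coord_dual_weight:
  fixes \<xi> :: "(real, 'n::{finite,linorder}) vec"
  assumes "1 \<le> j" "j \<le> CARD('n)"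
  shows "coord (dual_weight \<xi>) j = - coord \<xi> (CARD('n) + 1 - j)"
  using assms by (simp add: dual_weight_def coord_def card_atMost_nth_elem)

lemma coord_antimono:
  fixes \<xi> :: "(real, 'n::{finite,linorder}) vec"
  assumes "\<xi> \<in> dominant" "1 \<le> i" "i \<le> j" "j \<le> CARD('n)"
  shows "coord \<xi> j \<le> coord \<xi> i"
  using assms nth_elem_mono[of i j "UNIV :: 'n set"] by (auto simp: coord_def dominant_def)

lemma all_coord_iff:
  fixes \<xi> \<zeta> :: "(real, 'n::{finite,linorder}) vec"
  shows "(\<forall>i\<in>{1..CARD('n)}. coord \<xi> i \<ge> coord \<zeta> i) \<longleftrightarrow> (\<forall>k. \<zeta> $ k \<le> \<xi> $ k)"
proof -
  have "nth_elem (UNIV :: 'n set) ` {1..CARD('n)} = UNIV"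
    using bij_betw_nth_elem[of "UNIV :: 'n set"] by (simp add: bij_betw_def)
  then have "(\<forall>k. \<zeta> $ k \<le> \<xi> $ k) \<longleftrightarrow> (\<forall>k \<in> nth_elem (UNIV :: 'n set) ` {1..CARD('n)}. \<zeta> $ k \<le> \<xi> $ k)"
    by simp
  then show ?thesis by (simp add: coord_def)
qed

section \<open>Horn triples\<close>

lemma horn_T_subset_horn_U: "horn_T r n \<subseteq> horn_U r n"
  by (subst horn_T.simps) auto

lemma horn_T_1: "horn_T (Suc 0) n = horn_U (Suc 0) n"
  by (subst horn_T.simps) auto

text \<open>The only Horn inequalities needed are those of the triples \<open>({k}, {r + 1 - k}, {r}) \<in> T\<^sub>1\<^sup>r\<close>.\<close>

lemma horn_T_nth_elem_le:
  assumes T: "(I, J, L) \<in> horn_T r n" and k: "k \<in> {1..r}"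
  shows "nth_elem I k + nth_elem J (r + 1 - k) \<le> n + 1"
proof -
  from T have U: "(I, J, L) \<in> horn_U r n" using horn_T_subset_horn_U by blast
  then have sub: "I \<subseteq> {1..n}" "J \<subseteq> {1..n}" "L \<subseteq> {1..n}" and card: "card I = r" "card J = r" "card L = r"
    and sum: "\<Sum>I + \<Sum>J = \<Sum>L + r * (r + 1) div 2"
    by (auto simp: horn_U_def)
  have "finite L" using sub finite_subset by blast
  then have "nth_elem L r \<in> L"
    using bij_betw_nth_elem[of L] card k by (auto simp: bij_betw_def)
  then have Ln: "nth_elem L r \<le> n" using sub by auto
  show ?thesis
  \<comment> \<open>For \<open>r = 1\<close> the sum identity itself reads
    \<open>i + j = l + 1\<close>. For larger \<open>r\<close> the bound is the Horn inequality with
    \<open>p = 1\<close>, whose constant is also 1.\<close>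
  proof (cases "r = 1")
    case True
    then obtain i j l where "I = {i}" "J = {j}" "L = {l}" using card by (metis card_1_singletonE)
    with True k sum Ln show ?thesis by (simp add: nth_elem_singleton)
  next
    case False
    then have "Suc 0 \<in> {1..<r}" using k by auto
    with T have *: "\<forall>(F, G, H) \<in> horn_T (Suc 0) r.
        (\<Sum>f\<in>F. nth_elem I f) + (\<Sum>g\<in>G. nth_elem J g) \<le> (\<Sum>h\<in>H. nth_elem L h) + Suc 0 * (Suc 0 + 1) div 2"
      by (subst (asm) horn_T.simps) blast
    moreover have "({k}, {r + 1 - k}, {r}) \<in> horn_T (Suc 0) r"
      using k by (auto simp: horn_T_1 horn_U_def)
    ultimately show ?thesis using Ln by fastforce
  qed
qed

lemma horn_inequalities_iff:
  fixes \<Lambda> \<mu> :: "(real, 'n::{finite,linorder}) vec"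
  assumes n: "CARD('n) \<ge> 2" and \<Lambda>: "\<Lambda> \<in> dominant"
  shows "(\<forall>r \<in> {1..CARD('n) - 1}. \<forall>(I, J, L) \<in> horn_T r CARD('n).
             (\<Sum>i\<in>I. coord \<mu> i) + (\<Sum>j\<in>J. coord (dual_weight \<Lambda>) j) \<ge> 0) \<longleftrightarrow>
    (\<forall>i \<in> {1..CARD('n)}. coord \<mu> i \<ge> coord \<Lambda> i)"
proof (intro iffI ballI)
  fix i
  assume *: "\<forall>r \<in> {1..CARD('n) - 1}. \<forall>(I, J, L) \<in> horn_T r CARD('n).
    (\<Sum>i\<in>I. coord \<mu> i) + (\<Sum>j\<in>J. coord (dual_weight \<Lambda>) j) \<ge> 0" and i: "i \<in> {1..CARD('n)}"
  \<comment> \<open>The sum identity holds as \<open>i + (n + 1 - i) = n + 1\<close>, and the dual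
    weight at \<open>n + 1 - i\<close> is minus the coordinate \<open>i\<close> of
    \<open>\<Lambda>\<close>.\<close>
  have "({i}, {CARD('n) + 1 - i}, {CARD('n)}) \<in> horn_T (Suc 0) CARD('n)"
    using i by (auto simp: horn_T_1 horn_U_def)
  moreover have "Suc 0 \<in> {1..CARD('n) - 1}" using n by auto
  ultimately have "coord \<mu> i + coord (dual_weight \<Lambda>) (CARD('n) + 1 - i) \<ge> 0"
    using * by fastforce
  then show "coord \<mu> i \<ge> coord \<Lambda> i"
    using i by (subst (asm) coord_dual_weight) auto
next
  fix r T
  assume le: "\<forall>i \<in> {1..CARD('n)}. coord \<mu> i \<ge> coord \<Lambda> i" and "T \<in> horn_T r CARD('n)"
  have "(\<Sum>i\<in>I. coord \<mu> i) + (\<Sum>j\<in>J. coord (dual_weight \<Lambda>) j) \<ge> 0"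
    if T: "(I, J, L) \<in> horn_T r CARD('n)" for I J L
  proof -
    have sub: "I \<subseteq> {1..CARD('n)}" "J \<subseteq> {1..CARD('n)}" and card: "card I = r" "card J = r"
      using T horn_T_subset_horn_U by (fastforce simp: horn_U_def)+
    then have fin: "finite I" "finite J" using finite_subset by blast+
    note I = bij_betw_nth_elem[OF fin(1), unfolded card] and J = bij_betw_nth_elem[OF fin(2), unfolded card]
    \<comment> \<open>Reversing \<open>J\<close> pairs its elements with those of \<open>I\<close>
      so that each pair has a nonnegative contribution on its own.\<close>
    have rev: "bij_betw (\<lambda>k. r + 1 - k) {1..r} {1..r}"
      by (rule bij_betw_byWitness[where f' = "\<lambda>k. r + 1 - k"]) auto
    have sI: "(\<Sum>i\<in>I. coord \<mu> i) = (\<Sum>k\<in>{1..r}. coord \<mu> (nth_elem I k))"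
      using sum.reindex_bij_betw[OF I] by metis
    have sJ: "(\<Sum>j\<in>J. coord (dual_weight \<Lambda>) j)
        = (\<Sum>k\<in>{1..r}. coord (dual_weight \<Lambda>) (nth_elem J (r + 1 - k)))"
      using sum.reindex_bij_betw[OF bij_betw_trans[OF rev J], of "coord (dual_weight \<Lambda>)"]
      by (simp add: o_def)
    have nonneg: "coord \<mu> (nth_elem I k) + coord (dual_weight \<Lambda>) (nth_elem J (r + 1 - k)) \<ge> 0"
      if k: "k \<in> {1..r}" for k
    proof -
      have i: "nth_elem I k \<in> {1..CARD('n)}" using I k sub unfolding bij_betw_def by blast
      have "r + 1 - k \<in> {1..r}" using k by auto
      then have j: "nth_elem J (r + 1 - k) \<in> {1..CARD('n)}" using J sub unfolding bij_betw_def by blast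
      \<comment> \<open>The bound on the sum of the pair says that the element of \<open>I\<close>
        is at most \<open>n + 1\<close> minus the element of \<open>J\<close>, and
        \<open>\<Lambda>\<close> is decreasing.\<close>
      have "coord \<Lambda> (CARD('n) + 1 - nth_elem J (r + 1 - k)) \<le> coord \<Lambda> (nth_elem I k)"
        using horn_T_nth_elem_le[OF T k] i j by (intro coord_antimono[OF \<Lambda>]) auto
      also have "\<dots> \<le> coord \<mu> (nth_elem I k)" using le i by blast
      finally show ?thesis using j by (subst coord_dual_weight) auto
    qed
    show ?thesis unfolding sI sJ sum.distrib[symmetric] by (intro sum_nonneg nonneg)
  qed
  with \<open>T \<in> horn_T r CARD('n)\<close>
  show "case T of (I, J, L) \<Rightarrow> (\<Sum>i\<in>I. coord \<mu> i) + (\<Sum>j\<in>J. coord (dual_weight \<Lambda>) j) \<ge> 0"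
    by (cases T) blast
qed

section \<open>The cone of noncompact roots and the polyhedron\<close>

lemma double_axis_root: "axis k 1 + axis k 1 \<in> noncompact_roots"
  unfolding noncompact_roots_def by blast

lemma inner_double_axis: "(axis k 1 + axis k 1) \<bullet> \<xi> = 2 * \<xi> $ k" for \<xi> :: "real^'n"
  unfolding inner_add_left inner_axis' by simp

text \<open>All noncompact roots have nonnegative coordinates, and the long roots, twice the
  coordinate vectors, already generate the orthant.\<close>

lemma noncompact_cone_eq:
  "noncompact_cone = {\<xi> :: (real, 'n::{finite,linorder}) vec. \<forall>k. 0 \<le> \<xi> $ k}"
proof (intro equalityI subsetI)
  fix \<xi> :: "(real, 'n) vec" assume "\<xi> \<in> noncompact_cone"
  then obtain c where c: "\<forall>\<beta>\<in>noncompact_roots. 0 \<le> c \<beta>"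
    and \<xi>: "\<xi> = (\<Sum>\<beta>\<in>noncompact_roots. c \<beta> *\<^sub>R \<beta>)"
    by (auto simp: noncompact_cone_def)
  have "0 \<le> \<beta> $ k" if "\<beta> \<in> noncompact_roots" for \<beta> :: "(real, 'n) vec" and k
    using that by (auto simp: noncompact_roots_def axis_def)
  with c show "\<xi> \<in> {\<xi>. \<forall>k. 0 \<le> \<xi> $ k}"
    unfolding \<xi> by (auto intro!: sum_nonneg mult_nonneg_nonneg)
next
  fix \<xi> :: "(real, 'n) vec" assume \<xi>: "\<xi> \<in> {\<xi>. \<forall>k. 0 \<le> \<xi> $ k}"
  define D where "D = range (\<lambda>i::'n. axis i (1::real) + axis i 1)"
  \<comment> \<open>On the long root at \<open>i\<close> the inner product is
    \<open>2 * \<xi> $ i\<close>, so its coefficient is \<open>\<xi> $ i / 2\<close>.\<close>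
  define c where "c \<beta> = (if \<beta> \<in> D then (\<beta> \<bullet> \<xi>) / 4 else 0)" for \<beta>
  have D: "D \<subseteq> noncompact_roots" unfolding D_def using double_axis_root by blast
  have "noncompact_roots \<subseteq> range (\<lambda>(i::'n, j). axis i (1::real) + axis j 1)"
    by (auto simp: noncompact_roots_def)
  then have fin: "finite (noncompact_roots :: (real, 'n) vec set)" by (rule finite_subset) simp
  have inj: "inj (\<lambda>i::'n. axis i (1::real) + axis i 1)"
    by (rule injI) (simp add: axis_eq_axis flip: scaleR_2)
  have "(\<Sum>\<beta>\<in>noncompact_roots. c \<beta> *\<^sub>R \<beta>) = (\<Sum>\<beta>\<in>D. c \<beta> *\<^sub>R \<beta>)"
    using fin D by (intro sum.mono_neutral_right) (auto simp: c_def)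
  also have "\<dots> = (\<Sum>i\<in>UNIV. \<xi> $ i *\<^sub>R axis i 1)"
    unfolding D_def sum.reindex[OF inj]
    by (intro sum.cong refl) (simp add: c_def D_def inner_axis' flip: scaleR_2)
  also have "\<dots> = \<xi>"
    by (simp add: vec_eq_iff axis_def if_distrib[where f="\<lambda>x. _ * x"] cong: if_cong)
  finally have "\<xi> = (\<Sum>\<beta>\<in>noncompact_roots. c \<beta> *\<^sub>R \<beta>)" by simp
  moreover have "0 \<le> c \<beta>" for \<beta>
  proof (cases "\<beta> \<in> D")
    case True
    then obtain i where "\<beta> = axis i 1 + axis i 1" unfolding D_def by blast
    then have "\<beta> \<bullet> \<xi> = 2 * \<xi> $ i" by (simp only: inner_double_axis)
    then show ?thesis using \<xi> by (simp add: c_def)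
  qed (simp add: c_def)
  ultimately show "\<xi> \<in> noncompact_cone" unfolding noncompact_cone_def by blast
qed

lemma C_hol_pos: "\<Lambda> \<in> C_hol \<Longrightarrow> 0 < \<Lambda> $ k"
proof -
  assume "\<Lambda> \<in> C_hol"
  then have "0 < (axis k 1 + axis k 1) \<bullet> \<Lambda>" using double_axis_root unfolding C_hol_def by blast
  then show ?thesis unfolding inner_double_axis by simp
qed

lemma polyhedron_dominant_ge:
  fixes \<Lambda> :: "(real, 'n::{finite,linorder}) vec"
  shows "polyhedron (dominant \<inter> {\<mu>. \<forall>k. \<Lambda> $ k \<le> \<mu> $ k})"
proof -
  have "dominant \<inter> {\<mu>. \<forall>k. \<Lambda> $ k \<le> \<mu> $ k}
      = \<Inter> ((\<lambda>(i, j). {\<mu>. (axis i 1 - axis j 1) \<bullet> \<mu> \<ge> 0}) ` {(i, j). i \<le> j})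
        \<inter> \<Inter> (range (\<lambda>k. {\<mu>. axis k 1 \<bullet> \<mu> \<ge> \<Lambda> $ k}))"
    by (auto simp: dominant_def inner_diff_left inner_axis')
  then show ?thesis
    by (auto intro!: polyhedron_Int polyhedron_Inter polyhedron_halfspace_ge)
qed

theorem mainTheorem8:
  fixes \<Lambda> :: "real^'n::{finite,linorder}"
  assumes "CARD('n) \<ge> 2"
    and "\<Lambda> \<in> rational_dominant \<inter> C_hol"
  shows "(\<forall>\<mu> \<in> rational_dominant.
        (\<mu> \<in> Delta_K (coadjoint_orbit \<Lambda>) \<longleftrightarrow>
          (\<forall>r \<in> {1..CARD('n) - 1}. \<forall>(I, J, L) \<in> horn_T r CARD('n).
             (\<Sum>i\<in>I. coord \<mu> i) + (\<Sum>j\<in>J. coord (dual_weight \<Lambda>) j) \<ge> 0)) \<and>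
        (\<mu> \<in> Delta_K (coadjoint_orbit \<Lambda>) \<longleftrightarrow>
          (\<forall>i \<in> {1..CARD('n)}. coord \<mu> i \<ge> coord \<Lambda> i)))
    \<and> polyhedron (Delta_K (coadjoint_orbit \<Lambda>))
    \<and> Delta_K (coadjoint_orbit \<Lambda>) = (\<lambda>\<xi>. \<Lambda> + \<xi>) ` noncompact_cone \<inter> dominant"
proof -
  have \<Lambda>: "\<Lambda> \<in> dominant" "\<And>k. 0 < \<Lambda> $ k"
    using assms(2) C_hol_pos by (auto simp: rational_dominant_def)
  have Delta: "Delta_K (coadjoint_orbit \<Lambda>) = dominant \<inter> {\<mu>. \<forall>k. \<Lambda> $ k \<le> \<mu> $ k}"
    using mem_Delta_K_iff_le[OF \<Lambda>] by blast
  have le: "\<mu> \<in> Delta_K (coadjoint_orbit \<Lambda>) \<longleftrightarrow> (\<forall>i \<in> {1..CARD('n)}. coord \<mu> i \<ge> coord \<Lambda> i)"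
    if "\<mu> \<in> rational_dominant" for \<mu>
    using that by (simp only: Delta all_coord_iff) (simp add: rational_dominant_def)
  have "(\<lambda>\<xi>. \<Lambda> + \<xi>) ` noncompact_cone = {\<mu>. \<forall>k. \<Lambda> $ k \<le> \<mu> $ k}"
  proof (intro equalityI subsetI)
    fix \<mu> assume "\<mu> \<in> {\<mu>. \<forall>k. \<Lambda> $ k \<le> \<mu> $ k}"
    then have "\<mu> - \<Lambda> \<in> noncompact_cone" by (simp add: noncompact_cone_eq)
    then show "\<mu> \<in> (\<lambda>\<xi>. \<Lambda> + \<xi>) ` noncompact_cone" by (rule rev_image_eqI) simp
  qed (auto simp: noncompact_cone_eq)
  then have "Delta_K (coadjoint_orbit \<Lambda>) = (\<lambda>\<xi>. \<Lambda> + \<xi>) ` noncompact_cone \<inter> dominant"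
    by (simp add: Delta Int_commute)
  moreover have "polyhedron (Delta_K (coadjoint_orbit \<Lambda>))"
    unfolding Delta by (rule polyhedron_dominant_ge)
  ultimately show ?thesis
    unfolding horn_inequalities_iff[OF assms(1) \<Lambda>(1)] using le by blast
qed

end
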